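(* Let $p \geq 2$ be an integer, let $k \in (1/2,1]$, let $\phi \in (0,\pi/(2p))$ and let $v>0$. Then $$\sum_{j \geq 0}\frac{\Gamma(p(j+1))}{\Gamma(2p(j+k))}\,v^{pj}\,{}_1F_1\left(p(j+1),\, 2p(j+k)+1;\, v\right)C_{j}^{(k)}(\cos(2p\phi)) = \frac{\Gamma(p)\Gamma(pk)}{[\Gamma(k)]^p\,\Gamma(2pk)} \int_{\Sigma_p}du_1 \ldots du_{p-1} \prod_{s=1}^p u_s^{k-1}\; {}_1F_1 \left(p,\, pk+\frac{1}{2};\, v \sum_{s=1}^p u_s \cos^{2}\left(\phi + \frac{s\pi}{p}\right)\right).$$
   Context: The Pochhammer symbol is $(a)_m = a(a+1)\cdots(a+m-1)$, with $(a)_0=1$. The confluent hypergeometric function is ${}_1F_1(a,c;z) = \sum_{m \geq 0} \frac{(a)_m}{(c)_m}\frac{z^m}{m!}$. The Gegenbauer (ultraspherical) polynomial of degree $j$ and parameter $\lambda \neq 0$ is $$C_j^{(\lambda)}(z) = \frac{(2\lambda)_j}{j!}\,{}_2F_1\left(-j,\, j+2\lambda;\, \lambda+\tfrac12;\, \tfrac{1-z}{2}\right),$$ where ${}_2F_1$ is the Gauss hypergeometric function. The set $\Sigma_p = \{(u_1,\ldots,u_p) : u_1,\ldots,u_p \geq 0,\ u_1+\cdots+u_p = 1\}$ is the standard simplex in $\mathbb{R}^p$. The integral over $\Sigma_p$ with respect to $du_1\ldots du_{p-1}$ is the Lebesgue integral over $\{(u_1,\ldots,u_{p-1}) : u_i\ge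 0,\ u_1+\cdots+u_{p-1}\le 1\}$ with $u_p = 1-u_1-\cdots-u_{p-1}$. *)

theory Defs
  imports "HOL-Analysis.Analysis"
begin

definition hyp1F1 :: "real \<Rightarrow> real \<Rightarrow> real \<Rightarrow> real" where
  "hyp1F1 a c z = (\<Sum>m. pochhammer a m / pochhammer c m * (z ^ m / fact m))"

definition hyp2F1 :: "real \<Rightarrow> real \<Rightarrow> real \<Rightarrow> real \<Rightarrow> real" where
  "hyp2F1 a b c z = (\<Sum>m. pochhammer a m * pochhammer b m / pochhammer c m * (z ^ m / fact m))"

text \<open>
  The series terminates here, since \<open>pochhammer (- real j) m = 0\<close> for \<open>m > j\<close>.
\<close>

definition gegenbauer :: "nat \<Rightarrow> real \<Rightarrow> real \<Rightarrow> real" where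
  "gegenbauer j l z =
     pochhammer (2 * l) j / fact j * hyp2F1 (- real j) (real j + 2 * l) (l + 1 / 2) ((1 - z) / 2)"

text \<open>
  A point \<open>(u\<^sub>1, \<dots>, u\<^sub>p)\<close> is a function on \<open>{1..p}\<close>; its first \<open>p - 1\<close> coordinates, which
  carry the Lebesgue measure, form an element of the product space over the index set \<open>{1..<p}\<close>,
  and the last one is determined by them.
\<close>

definition simplex_coords :: "nat \<Rightarrow> (nat \<Rightarrow> real) set" where
  "simplex_coords p =
     {u \<in> {1..<p} \<rightarrow>\<^sub>E UNIV. (\<forall>i\<in>{1..<p}. 0 \<le> u i) \<and> (\<Sum>i\<in>{1..<p}. u i) \<le> 1}"

definition simplex_integral :: "nat \<Rightarrow> ((nat \<Rightarrow> real) \<Rightarrow> real) \<Rightarrow> real" where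
  "simplex_integral p f =
     set_lebesgue_integral (Pi\<^sub>M {1..<p} (\<lambda>_. lborel)) (simplex_coords p)
       (\<lambda>u. f (u(p := 1 - (\<Sum>i\<in>{1..<p}. u i))))"

text \<open>
  The two hypergeometric functions agree with the evaluation of the formal series of the library.
\<close>

lemma hyp1F1_eq_eval_fps: "hyp1F1 a c z = eval_fps (fps_hypergeo [a] [c] 1) z"
  by (simp add: hyp1F1_def eval_fps_def fps_hypergeo_nth mult_ac)

lemma hyp2F1_eq_eval_fps: "hyp2F1 a b c z = eval_fps (fps_hypergeo [a, b] [c] 1) z"
  by (simp add: hyp2F1_def eval_fps_def fps_hypergeo_nth mult_ac)

end

theory Submission
  imports Defs "HOL-Computational_Algebra.Fundamental_Theorem_Algebra"
begin

text \<open>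
  Expand the right-hand side in powers of \<open>v\<close>. With \<open>z\<^sub>s = cos\<^sup>2 (\<phi> + s \<pi> / p)\<close>, the Dirichlet integral of
  \<open>(\<Sum> u\<^sub>s z\<^sub>s)\<^sup>m\<close> is, up to Gamma factors, the coefficient of \<open>t\<^sup>m\<close> in \<open>\<Prod> (1 - t z\<^sub>s) powr (-k)\<close>.
  The substitution \<open>t = 4r / (1 + r)\<^sup>2\<close> makes this product
  \<open>(1 + r) powr (2pk) * (1 - 2 r\<^sup>p cos (2p\<phi>) + r\<^bsup>2p\<^esup>) powr (-k)\<close>, whose last factor generates the
  Gegenbauer polynomials in \<open>r\<^sup>p\<close>. Writing \<open>r\<^bsup>pj\<^esup> (1 + r) powr (2pk)\<close> as a hypergeometric series in \<open>t\<close>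
  gives the coefficients in \<open>t\<close>, and the resulting double series is absolutely convergent because
  \<open>\<bar>C\<^sub>j\<bar> \<le> 3\<^sup>j\<close>, so it may be summed along \<open>j\<close> first.
\<close>

text \<open>Every generating function identity is proved for formal power series, so radii of
  convergence never matter there; analysis enters only through the Dirichlet integral and the final
  double series. The substitution is chosen because it turns each linear factor, up to (1 + r)^2,
  into a quadratic with roots exp(\<plusminus>2i\<theta>). Doubling spaces the angles \<phi> +
  s\<pi>/p equally over the full circle, which lets the p quadratics collapse into one quadratic in
  r^p. The return to t rests on the quadratic transformation 2F1(a, a + 1/2; 2a + 1; t) = (1 +
  r)^(2a), used with a = p(j + k). The parameter pk + 1/2 of the 1F1 under the integral is the one
  for which Legendre duplication merges (pk + 1/2)_m with the factor Gamma(pk + m) of the Dirichlet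
  integral. The two sides call for different convergence arguments: under the integral all terms are
  nonnegative, since z_s is a square, and monotone convergence suffices; on the left the Gegenbauer
  values may change sign, so they have to be bounded.\<close>

unbundle no vec_syntax and fps_syntax

section \<open>Real powers of formal power series and Gegenbauer polynomials\<close>

text \<open>This is \<open>f\<close> to the real power \<open>c\<close>, written as the binomial
  series (1 + X)^c at \<open>f - 1\<close>. It carries that meaning for \<open>f $ 0 = 1\<close>,
  where the inner series has no constant term.\<close>

definition fps_rpow :: "real fps \<Rightarrow> real \<Rightarrow> real fps" where
  "fps_rpow f c = fps_binomial c oo (f - 1)"

lemma fps_rpow_nth_0 [simp]: "fps_rpow f c $ 0 = 1"
  by (simp add: fps_rpow_def)

text \<open>The equation (1 + X) B' = c B of the binomial series, composed with
  \<open>f - 1\<close>. Together with the constant term 1 it characterises the power, and for the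
  Gegenbauer generating function it is the source of the three-term recurrence.\<close>

lemma fps_rpow_ODE:
  assumes "f $ 0 = 1"
  shows "f * fps_deriv (fps_rpow f c) = fps_const c * fps_deriv f * fps_rpow f c"
proof -
  have f0: "(f - 1) $ 0 = 0" using assms by simp
  have "(1 + fps_X) * fps_deriv (fps_binomial c) = fps_const c * fps_binomial c"
    unfolding fps_binomial_deriv by (simp add: fps_divide_unit mult_ac inverse_mult_eq_1')
  then have "((1 + fps_X) * fps_deriv (fps_binomial c)) oo (f - 1) = (fps_const c * fps_binomial c) oo (f - 1)"
    by simp
  then have "f * (fps_deriv (fps_binomial c) oo (f - 1)) = fps_const c * fps_rpow f c"
    using f0 by (simp add: fps_compose_mult_distrib fps_compose_add_distrib fps_rpow_def)
  moreover have "fps_deriv (fps_rpow f c) = (fps_deriv (fps_binomial c) oo (f - 1)) * fps_deriv f"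
    using f0 by (simp add: fps_rpow_def fps_compose_deriv)
  ultimately show ?thesis
    by (metis mult.assoc mult.commute)
qed

text \<open>The quotient of \<open>g\<close> by the power has derivative zero, so it equals its
  constant term 1.\<close>

lemma fps_rpow_unique:
  assumes f: "f $ 0 = 1" and ode: "f * fps_deriv g = fps_const c * fps_deriv f * g" and g: "g $ 0 = 1"
  shows "g = fps_rpow f c"
proof -
  let ?P = "fps_rpow f c"
  have P: "?P * inverse ?P = 1"
    by (simp add: inverse_mult_eq_1' )
  \<comment> \<open>The factor \<open>f * ?P * ?P\<close> clears the denominators, so that both
    differential equations can be substituted and cancel.\<close>
  have "fps_deriv (g * inverse ?P) * (f * ?P * ?P) =
      (f * fps_deriv g) * ?P * (?P * inverse ?P) - g * (f * fps_deriv ?P) * (?P * inverse ?P) * (?P * inverse ?P)"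
    by (simp add: fps_inverse_deriv power2_eq_square algebra_simps)
  also have "\<dots> = 0"
    unfolding P ode fps_rpow_ODE[OF f] by (simp add: algebra_simps)
  finally have "fps_deriv (g * inverse ?P) * (f * ?P * ?P) = 0" .
  moreover have "f * ?P * ?P \<noteq> 0"
    using f by (intro fps_nonzeroI[of _ 0]) simp
  ultimately have "fps_deriv (g * inverse ?P) = 0"
    by (metis mult_eq_0_iff)
  then have "g * inverse ?P = fps_const ((g * inverse ?P) $ 0)"
    by (simp only: fps_deriv_eq_0_iff)
  also have "\<dots> = 1" using g by simp
  finally show ?thesis
    using P by (metis mult.left_commute mult.right_neutral)
qed

text \<open>Logarithmic derivatives add, so the product of the powers solves the equation that
  characterises the power of the product.\<close>

lemma fps_rpow_mult:
  assumes f: "f $ 0 = 1" and g: "g $ 0 = 1"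
  shows "fps_rpow (f * g) c = fps_rpow f c * fps_rpow g c"
proof (rule sym, rule fps_rpow_unique)
  have "f * g * fps_deriv (fps_rpow f c * fps_rpow g c) =
      (f * fps_deriv (fps_rpow f c)) * (g * fps_rpow g c) + (g * fps_deriv (fps_rpow g c)) * (f * fps_rpow f c)"
    by (simp add: algebra_simps)
  also have "\<dots> = fps_const c * fps_deriv (f * g) * (fps_rpow f c * fps_rpow g c)"
    unfolding fps_rpow_ODE[OF f] fps_rpow_ODE[OF g] by (simp add: algebra_simps)
  finally show "f * g * fps_deriv (fps_rpow f c * fps_rpow g c) =
     fps_const c * fps_deriv (f * g) * (fps_rpow f c * fps_rpow g c)" .
qed (use assms in simp_all)

lemma fps_rpow_one [simp]: "fps_rpow 1 c = 1"
  by (simp add: fps_rpow_def)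

lemma fps_rpow_prod:
  assumes "\<And>s. s \<in> S \<Longrightarrow> f s $ 0 = 1"
  shows "fps_rpow (\<Prod>s\<in>S. f s) c = (\<Prod>s\<in>S. fps_rpow (f s) c)"
  using assms
proof (induction S rule: infinite_finite_induct)
  case (insert x F)
  have "(\<Prod>s\<in>F. f s) $ 0 = 1"
    using insert.prems by (induction F rule: infinite_finite_induct) auto
  with insert show ?case by (simp add: fps_rpow_mult)
qed auto

lemma fps_rpow_add:
  assumes "f $ 0 = 1"
  shows "fps_rpow f (c + d) = fps_rpow f c * fps_rpow f d"
  using assms by (simp add: fps_rpow_def fps_binomial_add_mult fps_compose_mult_distrib)

lemma fps_rpow_of_nat:
  assumes "f $ 0 = 1"
  shows "fps_rpow f (real n) = f ^ n"
  using assms by (simp add: fps_rpow_def fps_binomial_of_nat fps_compose_add_distrib flip: fps_compose_power)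

lemma fps_rpow_power:
  assumes "f $ 0 = 1"
  shows "fps_rpow (f ^ n) c = fps_rpow f (real n * c)"
proof (induction n)
  case 0
  then show ?case by (simp add: fps_rpow_def)
next
  case (Suc n)
  have "(f ^ n) $ 0 = 1" using assms by (simp add: fps_power_zeroth)
  with Suc assms show ?case by (simp add: fps_rpow_mult fps_rpow_add algebra_simps)
qed

lemma fps_rpow_compose:
  assumes "f $ 0 = 1" "h $ 0 = 0"
  shows "fps_rpow f c oo h = fps_rpow (f oo h) c"
  using assms by (simp add: fps_rpow_def fps_compose_assoc[symmetric] fps_compose_sub_distrib)

lemma fps_rpow_one_plus_X: "fps_rpow (1 + fps_X) c = fps_binomial c"
  by (simp add: fps_rpow_def)

lemma fps_rpow_uminus:
  assumes "f $ 0 = 1"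
  shows "fps_rpow f c * fps_rpow f (- c) = 1"
  using fps_rpow_add[OF assms, of c "-c"] by (simp add: fps_rpow_def)

lemma fps_rpow_linear_nth:
  "fps_rpow (1 - fps_const z * fps_X) (- c) $ n = pochhammer c n / fact n * z ^ n"
proof -
  have "fps_rpow (1 - fps_const z * fps_X) (- c) = fps_binomial (- c) oo (fps_const (- z) * fps_X)"
    by (simp add: fps_rpow_def flip: fps_const_neg)
  moreover have "(- z) ^ n * (- 1) ^ n = z ^ n"
    by (simp flip: power_mult_distrib)
  ultimately show ?thesis
    by (simp add: fps_compose_linear gbinomial_pochhammer)
qed

text \<open>Split \<open>1 - 2xr + r\<^sup>2 = (1 - r)\<^sup>2 + 4yr\<close> with \<open>y = (1 - x) / 2\<close> and expand in powers of \<open>y\<close>.\<close>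

lemma gegenbauer_generating_function:
  assumes "0 < k"
  shows "fps_rpow (1 - fps_const (2 * x) * fps_X + fps_X\<^sup>2) (- k) $ j = gegenbauer j k x"
proof -
  define y where "y = (1 - x) / 2"
  define A where "A = (1 - fps_X :: real fps)"
  \<comment> \<open>Chosen so that the quadratic is \<open>A\<^sup>2 * (1 + U)\<close>. As
    \<open>U\<close> has no constant term, (1 + U)^(-k) can be expanded in powers of
    \<open>U\<close>.\<close>
  define U where "U = fps_const (4 * y) * fps_X * inverse (A\<^sup>2)"
  have A0: "A $ 0 = 1" by (simp add: A_def)
  have A0': "(A\<^sup>2) $ 0 = 1" by (simp add: A_def power2_eq_square)
  have Alin: "A = 1 - fps_const 1 * fps_X" by (simp add: A_def)
  have invA: "inverse (A\<^sup>2) = fps_rpow A (- 2)"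
    using fps_rpow_uminus[OF A0, of 2] fps_rpow_of_nat[OF A0, of 2] A0'
    by (simp add: fps_inverse_unique)
  have U0: "U $ 0 = 0" by (simp add: U_def)
  have Upow: "U ^ m = fps_const ((4 * y) ^ m) * fps_X ^ m * fps_rpow A (- 2 * real m)" for m
  proof -
    have "fps_rpow A (- 2) ^ m = fps_rpow A (- 2 * real m)"
      by (induction m) (simp_all add: fps_rpow_add[OF A0, symmetric] algebra_simps, simp add: fps_rpow_def)
    then show ?thesis
      by (simp add: U_def invA power_mult_distrib fps_const_power)
  qed
  have "1 - fps_const (2 * x) * fps_X + fps_X\<^sup>2 = A\<^sup>2 + fps_const (4 * y) * fps_X"
  proof -
    have "fps_const (4 * y) = 2 - fps_const (2 * x)"
      by (simp add: y_def numeral_fps_const field_simps)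
    then show ?thesis
      by (simp add: A_def power2_eq_square algebra_simps)
  qed
  also have "\<dots> = A\<^sup>2 * (1 + U)"
    using A0' by (simp add: U_def algebra_simps inverse_mult_eq_1')
  finally have "fps_rpow (1 - fps_const (2 * x) * fps_X + fps_X\<^sup>2) (- k) = fps_rpow (A\<^sup>2 * (1 + U)) (- k)"
    by simp
  also have "\<dots> = fps_rpow A (- 2 * k) * (fps_binomial (- k) oo U)"
    using A0 A0' U0 by (simp add: fps_rpow_mult fps_rpow_power) (simp add: fps_rpow_def)
  finally have "fps_rpow (1 - fps_const (2 * x) * fps_X + fps_X\<^sup>2) (- k) $ j =
     (\<Sum>l\<le>j. fps_rpow A (- 2 * k) $ (j - l) * (\<Sum>m\<le>l. fps_binomial (- k) $ m * (U ^ m) $ l))"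
    by (subst mult.commute) (simp add: fps_mult_nth fps_compose_nth atLeast0AtMost mult_ac)
  \<comment> \<open>Raising the inner bound from \<open>l\<close> to \<open>j\<close> adds only
    zeros, because \<open>U ^ m\<close> has no coefficient below degree \<open>m\<close>; the two
    sums can then be exchanged.\<close>
  also have "\<dots> = (\<Sum>l\<le>j. fps_rpow A (- 2 * k) $ (j - l) * (\<Sum>m\<le>j. fps_binomial (- k) $ m * (U ^ m) $ l))"
    using U0 by (intro sum.cong refl arg_cong2[where f = "(*)"] sum.mono_neutral_left) (auto simp: startsby_zero_power_prefix)
  also have "\<dots> = (\<Sum>m\<le>j. fps_binomial (- k) $ m * (\<Sum>l\<le>j. (U ^ m) $ l * fps_rpow A (- 2 * k) $ (j - l)))"
    by (simp add: sum_distrib_left mult_ac) (rule sum.swap)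
  also have "\<dots> = (\<Sum>m\<le>j. fps_binomial (- k) $ m * ((U ^ m * fps_rpow A (- 2 * k)) $ j))"
    by (simp add: fps_mult_nth atLeast0AtMost)
  also have "\<dots> = (\<Sum>m\<le>j. pochhammer (2 * k) (j + m) / (fact (j - m) * fact m * pochhammer (k + 1 / 2) m) * (- y) ^ m)"
  proof (intro sum.cong refl)
    fix m assume "m \<in> {..j}"
    then have m: "m \<le> j" by simp
    have "U ^ m * fps_rpow A (- 2 * k) = fps_const ((4 * y) ^ m) * (fps_X ^ m * fps_rpow A (- (2 * k + 2 * real m)))"
      using fps_rpow_add[OF A0, of "- 2 * real m" "- 2 * k"] by (simp add: Upow mult.assoc algebra_simps)
    then have 1: "(U ^ m * fps_rpow A (- 2 * k)) $ j = (4 * y) ^ m * (pochhammer (2 * k + 2 * real m) (j - m) / fact (j - m))"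
      using m fps_rpow_linear_nth[of 1 "2 * k + 2 * real m" "j - m"] by (simp add: fps_X_power_mult_nth Alin)
    \<comment> \<open>Duplication absorbs the 4^m coming from \<open>U ^ m\<close> and the (k)_m of
      the binomial coefficient, and leaves (k + 1/2)_m in the denominator.\<close>
    have 2: "pochhammer (2 * k) (2 * m) = 4 ^ m * pochhammer k m * pochhammer (k + 1 / 2) m"
      using pochhammer_double[of k m] by (simp add: power_mult)
    have 3: "pochhammer (2 * k) (j + m) = pochhammer (2 * k) (2 * m) * pochhammer (2 * k + 2 * real m) (j - m)"
      using pochhammer_product'[of "2 * k" "2 * m" "j - m"] m by (simp add: add.commute)
    have 4: "pochhammer (k + 1 / 2) m > 0" using assms by (intro pochhammer_pos) simp
    show "fps_binomial (- k) $ m * ((U ^ m * fps_rpow A (- 2 * k)) $ j) =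
        pochhammer (2 * k) (j + m) / (fact (j - m) * fact m * pochhammer (k + 1 / 2) m) * (- y) ^ m"
      unfolding 1 3 2 using 4
      by (simp add: gbinomial_pochhammer power_minus[of y] power_mult_distrib mult_ac)
  qed
  also have "\<dots> = (\<Sum>m\<le>j. pochhammer (2 * k) j / fact j *
      (pochhammer (- real j) m * pochhammer (real j + 2 * k) m / pochhammer (k + 1 / 2) m * (y ^ m / fact m)))"
  proof (intro sum.cong refl)
    fix m assume "m \<in> {..j}"
    then have m: "m \<le> j" by simp
    have 1: "pochhammer (- real j) m = (- 1) ^ m * (fact j / fact (j - m))"
    proof -
      have "fact j = fact (j - m) * pochhammer (real j - real m + 1) m"
        using pochhammer_product'[of "1 :: real" "j - m" m] m
        by (simp add: of_nat_diff add.commute flip: pochhammer_fact)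
      then show ?thesis
        by (simp add: pochhammer_minus)
    qed
    have 2: "pochhammer (2 * k) (j + m) = pochhammer (2 * k) j * pochhammer (real j + 2 * k) m"
      by (simp add: pochhammer_product' add.commute)
    show "pochhammer (2 * k) (j + m) / (fact (j - m) * fact m * pochhammer (k + 1 / 2) m) * (- y) ^ m =
      pochhammer (2 * k) j / fact j *
      (pochhammer (- real j) m * pochhammer (real j + 2 * k) m / pochhammer (k + 1 / 2) m * (y ^ m / fact m))"
      unfolding 1 2 by (simp add: power_minus[of y] mult_ac)
  qed
  also have "\<dots> = gegenbauer j k x"
    unfolding gegenbauer_def hyp2F1_def sum_distrib_left[symmetric] y_def[symmetric]
    by (subst suminf_finite[of "{..j}"]) (auto simp: pochhammer_of_nat_eq_0_iff)
  finally show ?thesis .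
qed

text \<open>The differential equation of the generating function yields a three-term recurrence.
  Because of \<open>k \<le> 1\<close> and \<open>\<bar>x\<bar> \<le> 1\<close> its coefficients are
  at most 2(n + 2) and n + 2 in absolute value. A geometric bound is good enough, since it later
  meets a factorial.\<close>

lemma abs_gegenbauer_le:
  assumes "0 < k" "k \<le> 1" "\<bar>x\<bar> \<le> 1"
  shows "\<bar>gegenbauer j k x\<bar> \<le> 3 ^ j"
proof -
  define Q where "Q = 1 - fps_const (2 * x) * fps_X + fps_X\<^sup>2"
  define G where "G = fps_rpow Q (- k)"
  have C: "gegenbauer n k x = G $ n" for n
    using gegenbauer_generating_function[OF assms(1)] by (simp add: G_def Q_def)
  have "Q * fps_deriv G = fps_const (- k) * fps_deriv Q * G"
    unfolding G_def by (rule fps_rpow_ODE) (simp add: Q_def)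
  then have ode: "(Q * fps_deriv G) $ n = (fps_const (- k) * fps_deriv Q * G) $ n" for n
    by simp
  have dQ: "fps_deriv Q = fps_const 2 * fps_X - fps_const (2 * x)"
    by (simp add: Q_def power2_eq_square algebra_simps numeral_fps_const)
  have rec0: "G $ 1 = 2 * k * x"
    using ode[of 0] by (simp add: Q_def dQ G_def)
  have rec: "(real n + 2) * G $ (n + 2) = 2 * (real n + 1 + k) * x * G $ (n + 1) - (real n + 2 * k) * G $ n" for n
  proof -
    have "(Q * fps_deriv G) $ (n + 1) = (n + 2) * G $ (n + 2) - 2 * x * (n + 1) * G $ (n + 1) + n * G $ n"
      unfolding Q_def by (cases n) (simp_all add: algebra_simps fps_X_power_mult_nth power2_eq_square)
    moreover have "(fps_const (- k) * fps_deriv Q * G) $ (n + 1) = 2 * k * x * G $ (n + 1) - 2 * k * G $ n"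
      unfolding dQ by (simp add: algebra_simps)
    ultimately show ?thesis using ode[of "n + 1"] by (simp add: algebra_simps)
  qed
  have "\<bar>G $ j\<bar> \<le> 3 ^ j"
  proof (induction j rule: induct_nat_012)
    case 0
    then show ?case by (simp add: G_def)
  next
    case 1
    have "\<bar>k * x\<bar> \<le> 1" using assms by (simp add: abs_mult mult_le_one)
    then show ?case using rec0 by (simp add: abs_mult)
  next
    case (ge2 n)
    have "(real n + 2) * \<bar>G $ (n + 2)\<bar> = \<bar>2 * (real n + 1 + k) * x * G $ (n + 1) - (real n + 2 * k) * G $ n\<bar>"
      using arg_cong[OF rec[of n], of abs] by (simp add: abs_mult)
    also have "\<dots> \<le> \<bar>2 * (real n + 1 + k) * x * G $ (n + 1)\<bar> + \<bar>(real n + 2 * k) * G $ n\<bar>"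
      by simp
    also have "\<dots> = 2 * (real n + 1 + k) * \<bar>x\<bar> * \<bar>G $ (n + 1)\<bar> + (real n + 2 * k) * \<bar>G $ n\<bar>"
      using assms by (simp add: abs_mult)
    also have "\<dots> \<le> 2 * (real n + 2) * 1 * 3 ^ (n + 1) + (real n + 2) * 3 ^ n"
    proof -
      have "2 * (real n + 1 + k) * \<bar>x\<bar> \<le> 2 * (real n + 2) * 1"
        using assms by (intro mult_mono) auto
      moreover have "real n + 2 * k \<le> real n + 2"
        using assms by simp
      ultimately show ?thesis
        using assms ge2 by (intro add_mono[OF mult_mono mult_mono]) auto
    qed
    \<comment> \<open>This is where the base 3 is justified: 2 * 3 + 1 \<le> 3^2.\<close>
    also have "\<dots> \<le> (real n + 2) * 3 ^ (n + 2)"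
      by (simp add: algebra_simps)
    finally have "\<bar>G $ (n + 2)\<bar> \<le> 3 ^ (n + 2)"
      by (subst (asm) mult_le_cancel_left_pos) auto
    then show ?case by simp
  qed
  then show ?thesis by (simp add: C)
qed

section \<open>A quadratic substitution\<close>

text \<open>
  Under \<open>t = 4r / (1 + r)\<^sup>2\<close> one has \<open>1 - t cos\<^sup>2 \<theta> = (1 - 2r cos (2\<theta>) + r\<^sup>2) / (1 + r)\<^sup>2\<close>.
\<close>

definition quad_subst :: "real fps" where
  "quad_subst = 4 * fps_X * fps_binomial (- 2)"

text \<open>The Gauss series 2F1(a, a + 1/2; 2a + 1; t) as a formal series in t. For these
  parameters the quadratic substitution turns it into the plain power (1 + r)^(2a).\<close>

definition quad_hypergeo :: "real \<Rightarrow> real fps" where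
  "quad_hypergeo a = Abs_fps (\<lambda>n. pochhammer a n * pochhammer (a + 1 / 2) n / (pochhammer (2 * a + 1) n * fact n))"

lemma quad_subst_nth_0 [simp]: "quad_subst $ 0 = 0"
  by (simp add: quad_subst_def)

lemma quad_subst_nth_1: "quad_subst $ Suc 0 = 4"
  by (simp add: quad_subst_def numeral_fps_const mult.assoc)

lemma quad_subst_times: "quad_subst * (1 + fps_X)\<^sup>2 = 4 * fps_X"
proof -
  have "fps_binomial (- 2) * (1 + fps_X)\<^sup>2 = (fps_binomial (- 2 + 2) :: real fps)"
    unfolding fps_binomial_add_mult using fps_binomial_of_nat[of 2, where 'a = real] by simp
  then show ?thesis
    by (simp add: quad_subst_def mult.assoc)
qed

lemma one_minus_quad_subst: "(1 - quad_subst) * (1 + fps_X)\<^sup>2 = (1 - fps_X)\<^sup>2"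
proof -
  have "(1 - quad_subst) * (1 + fps_X)\<^sup>2 = (1 + fps_X)\<^sup>2 - quad_subst * (1 + fps_X)\<^sup>2"
    by (simp add: algebra_simps)
  then show ?thesis
    unfolding quad_subst_times by (simp add: power2_eq_square algebra_simps)
qed

text \<open>The chain rule for the Euler operator: dt/dr = 4(1 - r)/(1 + r)^3 makes t d/dt equal to
  (1 + r)/(1 - r) times r d/dr, stated here with the denominator cleared.\<close>

lemma fps_X_deriv_compose_quad_subst:
  "(1 - fps_X) * ((fps_X * fps_deriv f) oo quad_subst) = fps_X * (1 + fps_X) * fps_deriv (f oo quad_subst)"
proof -
  let ?T = quad_subst and ?X = "fps_X :: real fps"
  let ?g = "fps_deriv f oo ?T"
  have "fps_deriv (?T * (1 + ?X)\<^sup>2) = 4"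
    unfolding quad_subst_times by simp
  then have "fps_deriv ?T * (1 + ?X)\<^sup>2 + 2 * ?T * (1 + ?X) = 4"
    by (simp add: power2_eq_square algebra_simps)
  then have "(fps_deriv ?T * (1 + ?X)\<^sup>2 + 2 * ?T * (1 + ?X)) * (1 + ?X) = 4 * (1 + ?X)"
    by (rule arg_cong)
  moreover have "fps_deriv ?T * (1 + ?X) ^ 3 =
      (fps_deriv ?T * (1 + ?X)\<^sup>2 + 2 * ?T * (1 + ?X)) * (1 + ?X) - 2 * (?T * (1 + ?X)\<^sup>2)"
    by (simp add: power3_eq_cube power2_eq_square algebra_simps)
  ultimately have dT: "fps_deriv ?T * (1 + ?X) ^ 3 = 4 * (1 - ?X)"
    unfolding quad_subst_times by (simp add: algebra_simps)
  have "?X * (1 + ?X) * fps_deriv (f oo ?T) * (4 * (1 + ?X)\<^sup>2) = 4 * ?X * ?g * (fps_deriv ?T * (1 + ?X) ^ 3)"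
    by (simp add: fps_compose_deriv power3_eq_cube power2_eq_square algebra_simps)
  also have "\<dots> = ?T * ?g * (1 - ?X) * (4 * (1 + ?X)\<^sup>2)"
    unfolding dT quad_subst_times[symmetric] by (simp add: mult_ac)
  finally have "?X * (1 + ?X) * fps_deriv (f oo ?T) * (4 * (1 + ?X)\<^sup>2) = ?T * ?g * (1 - ?X) * (4 * (1 + ?X)\<^sup>2)" .
  moreover have "4 * (1 + ?X)\<^sup>2 \<noteq> 0"
    by (intro fps_nonzeroI[of _ 0]) (simp add: power2_eq_square numeral_fps_const)
  ultimately have "?X * (1 + ?X) * fps_deriv (f oo ?T) = ?T * ?g * (1 - ?X)"
    using mult_right_cancel by blast
  then show ?thesis
    by (simp add: fps_compose_mult_distrib mult_ac)
qed

text \<open>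
  With \<open>\<theta> = X d/dX\<close>, the substitution turns the hypergeometric equation
  \<open>(1 - t) (\<theta> + a)\<^sup>2 F = a\<^sup>2 F + (t / 2) (\<theta> + a) F\<close> into an identity satisfied by \<open>(1 + X) powr (2 a)\<close>.
\<close>

lemma quad_hypergeo_compose:
  assumes "0 < a"
  shows "quad_hypergeo a oo quad_subst = fps_binomial (2 * a)"
proof -
  let ?T = quad_subst and ?X = "fps_X :: real fps"
  define c where "c = fps_const a"
  have c [simp]: "fps_deriv c = 0" "c oo ?T = c"
    by (simp_all add: c_def)
  define B where "B = (fps_binomial (2 * a) :: real fps)"
  \<comment> \<open>The binomial series is pulled back through the compositional inverse, which
    exists because \<open>quad_subst\<close> has linear coefficient 4. What remains is to recognise
    the coefficients of \<open>F\<close>.\<close>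
  define F where "F = B oo fps_inv ?T"
  define E where "E = ?X * fps_deriv F + c * F"
  have FT: "F oo ?T = B"
  proof -
    have "F oo ?T = B oo (fps_inv ?T oo ?T)"
      unfolding F_def by (intro fps_compose_assoc[symmetric]) (simp_all add: fps_inv_def)
    then show ?thesis
      by (simp add: fps_inv quad_subst_nth_1)
  qed
  define e where "e = E oo ?T"
  define g where "g = (?X * fps_deriv E) oo ?T"
  have dB: "(1 + ?X) * fps_deriv B = 2 * c * B"
    unfolding B_def fps_binomial_deriv
    by (simp add: fps_divide_unit mult_ac inverse_mult_eq_1' numeral_fps_const c_def)
  have e: "(1 - ?X) * e = c * (1 + ?X) * B"
  proof -
    have "(1 - ?X) * e = (1 - ?X) * ((?X * fps_deriv F) oo ?T) + (1 - ?X) * c * B"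
      by (simp add: e_def E_def fps_compose_add_distrib fps_compose_mult_distrib FT distrib_left mult.assoc)
    also have "\<dots> = ?X * ((1 + ?X) * fps_deriv B) + (1 - ?X) * c * B"
      unfolding fps_X_deriv_compose_quad_subst FT by (simp add: mult_ac)
    also have "\<dots> = c * (1 + ?X) * B"
      unfolding dB by (simp add: algebra_simps)
    finally show ?thesis .
  qed
  have "fps_deriv ((1 - ?X) * e) = fps_deriv (c * (1 + ?X) * B)"
    by (simp only: e)
  then have "(1 - ?X) * fps_deriv e = e + c * B + c * ((1 + ?X) * fps_deriv B)"
    by (simp add: algebra_simps)
  then have de: "(1 - ?X) * fps_deriv e = e + c * B + 2 * c\<^sup>2 * B"
    unfolding dB by (simp add: algebra_simps power2_eq_square)
  have g: "(1 - ?X)\<^sup>2 * g = ?X * (1 + ?X) * (e + c * B + 2 * c\<^sup>2 * B)"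
  proof -
    have "(1 - ?X)\<^sup>2 * g = (1 - ?X) * ((1 - ?X) * g)"
      by (simp add: power2_eq_square mult_ac)
    also have "\<dots> = ?X * (1 + ?X) * ((1 - ?X) * fps_deriv e)"
      unfolding g_def fps_X_deriv_compose_quad_subst e_def by (simp add: mult_ac)
    finally show ?thesis by (simp only: de)
  qed
  \<comment> \<open>Twice the defect of the hypergeometric equation for \<open>F\<close>, with
    \<open>E\<close> in the role of (\<theta> + a) F; the doubling avoids the fraction t /
    2.\<close>
  define R where "R = 2 * ((1 - ?X) * (?X * fps_deriv E + c * E)) - 2 * c\<^sup>2 * F - ?X * E"
  have RT: "R oo ?T = 2 * ((1 - ?T) * (g + c * e)) - 2 * c\<^sup>2 * B - ?T * e"
    unfolding R_def fps_compose_sub_distrib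
    by (simp add: fps_compose_mult_distrib fps_compose_sub_distrib fps_compose_add_distrib FT g_def e_def
          fps_compose_power[symmetric])
  \<comment> \<open>The factor (1 + X)^2 makes both 1 - T and T polynomial and so produces exactly
    the combinations that \<open>g\<close> and \<open>e\<close> evaluate.\<close>
  have "(R oo ?T) * (1 + ?X)\<^sup>2 = 2 * (((1 - ?T) * (1 + ?X)\<^sup>2) * (g + c * e)) -
      2 * c\<^sup>2 * B * (1 + ?X)\<^sup>2 - (?T * (1 + ?X)\<^sup>2) * e"
    unfolding RT by (simp add: algebra_simps)
  also have "\<dots> = 2 * ((1 - ?X)\<^sup>2 * g) + 2 * c * (1 - ?X) * ((1 - ?X) * e) -
      2 * c\<^sup>2 * B * (1 + ?X)\<^sup>2 - 4 * ?X * e"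
    unfolding one_minus_quad_subst quad_subst_times by (simp add: algebra_simps power2_eq_square)
  also have "\<dots> = 2 * ?X * (1 + ?X) * (c * B + 2 * c\<^sup>2 * B) - 2 * ?X * ((1 - ?X) * e)
      + 2 * c * (1 - ?X) * ((1 - ?X) * e) - 2 * c\<^sup>2 * B * (1 + ?X)\<^sup>2"
    unfolding g by (simp add: algebra_simps power2_eq_square)
  also have "\<dots> = 0"
    unfolding e by (simp add: algebra_simps power2_eq_square)
  finally have "(R oo ?T) * (1 + ?X)\<^sup>2 = 0" .
  moreover have "(1 + ?X)\<^sup>2 \<noteq> 0"
    by (intro fps_nonzeroI[of _ 0]) (simp add: power2_eq_square)
  ultimately have "R oo ?T = 0"
    by (metis mult_eq_0_iff)
  then have "R oo ?T = 0 oo ?T"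
    by simp
  then have R0: "R = 0"
    by (subst (asm) fps_compose_inj_right) (simp_all add: quad_subst_nth_1)
  have E_nth: "E $ n = (real n + a) * F $ n" for n
    by (cases n) (simp_all add: E_def c_def algebra_simps)
  have R_nth: "R $ Suc n = 2 * (real n + 1 + a)\<^sup>2 * F $ Suc n - 2 * (real n + a)\<^sup>2 * F $ n -
      2 * a\<^sup>2 * F $ Suc n - (real n + a) * F $ n" for n
  proof -
    have eqs: "fps_const (2 * a) = 2 * c" "fps_const (2 * a\<^sup>2) = 2 * c\<^sup>2" "(fps_const 2 :: real fps) = 2"
      by (simp_all add: c_def numeral_fps_const power2_eq_square)
    have R: "R = fps_const 2 * (?X * fps_deriv E) - fps_const 2 * (?X * (?X * fps_deriv E)) +
        fps_const (2 * a) * E - fps_const (2 * a) * (?X * E) - fps_const (2 * a\<^sup>2) * F - ?X * E"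
      unfolding eqs by (simp add: R_def algebra_simps)
    show ?thesis
      unfolding R by (cases n) (simp_all add: E_nth, simp_all add: algebra_simps power2_eq_square)
  qed
  \<comment> \<open>The difference of squares (n + 1 + a)^2 - a^2 = (n + 1)(2a + 1 + n) leaves the
    two-term recurrence of the Gauss coefficients.\<close>
  have rec: "2 * (real n + 1) * (2 * a + 1 + real n) * F $ Suc n = (a + real n) * (2 * a + 1 + 2 * real n) * F $ n" for n
  proof -
    have "R $ Suc n = 0" using R0 by simp
    then show ?thesis using R_nth[of n] by algebra
  qed
  have "F $ n = quad_hypergeo a $ n" for n
  proof (induction n)
    case 0
    then show ?case by (simp add: F_def B_def quad_hypergeo_def)
  next
    case (Suc n)
    have pos: "pochhammer (2 * a + 1) n > 0"
      using assms by (intro pochhammer_pos) simp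
    have "2 * (real n + 1) * (2 * a + 1 + real n) > 0"
      using assms by (intro mult_pos_pos) auto
    then have "F $ Suc n = (a + real n) * (2 * a + 1 + 2 * real n) * F $ n / (2 * (real n + 1) * (2 * a + 1 + real n))"
      using rec[of n] by (metis less_irrefl nonzero_mult_div_cancel_left)
    also have "\<dots> = (a + real n) * (a + 1 / 2 + real n) / ((real n + 1) * (2 * a + 1 + real n)) * F $ n"
    proof -
      have num: "(a + real n) * (2 * a + 1 + 2 * real n) * F $ n = 2 * ((a + real n) * (a + 1 / 2 + real n) * F $ n)"
        by (simp add: algebra_simps)
      show ?thesis
        unfolding num mult.assoc[of 2] by (subst mult_divide_mult_cancel_left) simp_all
    qed
    also have "\<dots> = quad_hypergeo a $ Suc n"
      unfolding Suc using assms pos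
      by (simp add: quad_hypergeo_def pochhammer_Suc mult_ac add_ac)
    finally show ?case .
  qed
  then have "F = quad_hypergeo a" by (simp add: fps_eq_iff)
  then show ?thesis using FT by (simp add: B_def)
qed

section \<open>Products over the p-th roots of unity\<close>

lemma prod_one_minus_roots_of_unity:
  assumes "0 < p"
  shows "(\<Prod>s = 1..p. 1 - a * cis (2 * pi * real s / real p)) = 1 - a ^ p"
proof (cases "a = 0")
  case True
  then show ?thesis using assms by (simp add: power_0_left)
next
  case False
  let ?w = "\<lambda>s. cis (2 * pi * real s / real p)"
  define q where "q = (monom 1 p - 1 :: complex poly)"
  have deg: "degree q = p" and lc: "lead_coeff q = 1"
  proof -
    have "degree (- 1 :: complex poly) < degree (monom 1 p :: complex poly)"
      using assms by (simp add: degree_monom_eq)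
    then show "degree q = p"
      using degree_add_eq_left[of "- 1" "monom 1 p :: complex poly"] by (simp add: q_def degree_monom_eq)
    then show "lead_coeff q = 1"
      using assms by (simp add: q_def)
  qed
  have roots: "{z. poly q z = 0} = {z. z ^ p = 1}"
    by (auto simp: q_def poly_monom)
  \<comment> \<open>There is no common root with the derivative p z^(p - 1), so \<open>q\<close> is
    the product of its distinct linear factors.\<close>
  have "rsquarefree q"
    using assms unfolding rsquarefree_roots
    by (auto simp: q_def poly_monom pderiv_diff pderiv_monom power_0_left)
  then have "q = (\<Prod>z | z ^ p = 1. [:- z, 1:])"
    using complex_poly_decompose_rsquarefree[of q] lc roots by simp
  also have "\<dots> = (\<Prod>s<p. [:- ?w s, 1:])"
    using Complex.bij_betw_roots_unity[OF assms] by (intro prod.reindex_bij_betw[symmetric])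
  \<comment> \<open>The indices 0 and \<open>p\<close> name the same root 1, so the range can be
    shifted.\<close>
  also have "\<dots> = (\<Prod>s = 1..p. [:- ?w s, 1:])"
    using assms by (intro prod.reindex_bij_witness[of _ "\<lambda>s. if s = p then 0 else s" "\<lambda>s. if s = 0 then p else s"]) auto
  finally have "poly q (1 / a) = (\<Prod>s = 1..p. 1 / a - ?w s)"
    by (simp add: poly_prod)
  then have "a ^ p * ((1 / a) ^ p - 1) = a ^ p * (\<Prod>s = 1..p. 1 / a - ?w s)"
    by (simp add: q_def poly_monom)
  also have "\<dots> = (\<Prod>s = 1..p. a * (1 / a - ?w s))"
    by (simp add: prod.distrib)
  finally show ?thesis
    using False by (simp add: algebra_simps power_divide)
qed

text \<open>Each factor is the squared modulus of 1 - r exp(it). Multiplicativity of the modulus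
  reduces the product to the one over the roots of unity, with a = r exp(i\<theta>).\<close>

lemma prod_quadratic_cos:
  fixes r :: real
  assumes "0 < p"
  shows "(\<Prod>s = 1..p. 1 - 2 * r * cos (\<theta> + 2 * pi * real s / real p) + r\<^sup>2) =
    1 - 2 * r ^ p * cos (real p * \<theta>) + (r ^ p)\<^sup>2"
proof -
  have norm: "(cmod (1 - of_real r * cis t))\<^sup>2 = 1 - 2 * r * cos t + r\<^sup>2" for r t
  proof -
    have "(cmod (1 - of_real r * cis t))\<^sup>2 = (1 - r * cos t)\<^sup>2 + (r * sin t)\<^sup>2"
      by (simp add: cmod_power2)
    then show ?thesis
      by (simp add: power_mult_distrib power2_diff sin_squared_eq algebra_simps)
  qed
  have "(\<Prod>s = 1..p. 1 - 2 * r * cos (\<theta> + 2 * pi * real s / real p) + r\<^sup>2) =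
      (\<Prod>s = 1..p. (cmod (1 - of_real r * cis (\<theta> + 2 * pi * real s / real p)))\<^sup>2)"
    by (simp only: norm)
  also have "\<dots> = (cmod (\<Prod>s = 1..p. 1 - (of_real r * cis \<theta>) * cis (2 * pi * real s / real p)))\<^sup>2"
    by (simp add: prod_norm[symmetric] prod_power_distrib mult.assoc cis_mult)
  also have "\<dots> = (cmod (1 - of_real (r ^ p) * cis (real p * \<theta>)))\<^sup>2"
    by (simp only: prod_one_minus_roots_of_unity[OF assms])
       (simp add: power_mult_distrib Complex.DeMoivre)
  finally show ?thesis by (simp only: norm)
qed

text \<open>Real polynomials that agree at every real point are equal, so the pointwise identity
  becomes one of polynomials and then of formal power series.\<close>

lemma prod_fps_quadratic_cos:
  assumes "0 < p"
  shows "(\<Prod>s = 1..p. 1 - fps_const (2 * cos (\<theta> + 2 * pi * real s / real p)) * fps_X + fps_X\<^sup>2) =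
    1 - fps_const (2 * cos (real p * \<theta>)) * fps_X ^ p + (fps_X ^ p)\<^sup>2"
proof -
  let ?c = "\<lambda>s. 2 * cos (\<theta> + 2 * pi * real s / real p)"
  have "poly (\<Prod>s = 1..p. 1 - [:?c s:] * [:0, 1:] + [:0, 1:]\<^sup>2) =
     poly (1 - [:2 * cos (real p * \<theta>):] * [:0, 1:] ^ p + ([:0, 1:] ^ p)\<^sup>2)"
  proof
    fix r
    show "poly (\<Prod>s = 1..p. 1 - [:?c s:] * [:0, 1:] + [:0, 1:]\<^sup>2) r =
     poly (1 - [:2 * cos (real p * \<theta>):] * [:0, 1:] ^ p + ([:0, 1:] ^ p)\<^sup>2) r"
      using prod_quadratic_cos[OF assms, of r \<theta>] by (simp add: poly_prod poly_power mult_ac)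
  qed
  then have "(\<Prod>s = 1..p. 1 - [:?c s:] * [:0, 1:] + [:0, 1:]\<^sup>2) =
     1 - [:2 * cos (real p * \<theta>):] * [:0, 1:] ^ p + ([:0, 1:] ^ p)\<^sup>2"
    by (simp only: poly_eq_poly_eq_iff)
  then have "fps_of_poly (\<Prod>s = 1..p. 1 - [:?c s:] * [:0, 1:] + [:0, 1:]\<^sup>2) =
     fps_of_poly (1 - [:2 * cos (real p * \<theta>):] * [:0, 1:] ^ p + ([:0, 1:] ^ p)\<^sup>2)"
    by (rule arg_cong)
  then show ?thesis
    by (simp only: fps_of_poly_prod fps_of_poly_add fps_of_poly_diff fps_of_poly_mult fps_of_poly_power
        fps_of_poly_const fps_of_poly_fps_X fps_of_poly_1)
qed

section \<open>The product of the linear factors and its coefficients\<close>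

lemma dihedral_compose_quad_subst:
  assumes "0 < p" "0 < k"
  shows "fps_rpow (\<Prod>s = 1..p. 1 - fps_const ((cos (\<phi> + real s * pi / real p))\<^sup>2) * fps_X) (- k) oo quad_subst =
    fps_binomial (2 * real p * k) * (Abs_fps (\<lambda>j. gegenbauer j k (cos (2 * real p * \<phi>))) oo fps_X ^ p)"
proof -
  let ?z = "\<lambda>s. (cos (\<phi> + real s * pi / real p))\<^sup>2" and ?T = quad_subst and ?X = "fps_X :: real fps"
  let ?x = "cos (2 * real p * \<phi>)"
  define e where "e = fps_rpow (\<Prod>s = 1..p. 1 - fps_const (?z s) * ?X) (- k)"
  define Q where "Q = 1 - fps_const (2 * ?x) * ?X + ?X\<^sup>2"
  have X0: "(?X ^ p) $ 0 = 0" using assms by simp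
  have pr0: "(\<Prod>s\<in>S. 1 - fps_const (?z s) * h) $ 0 = 1" if "h $ 0 = 0" for S and h :: "real fps"
    using that by (induction S rule: infinite_finite_induct) auto
  have "e oo ?T = fps_rpow ((\<Prod>s = 1..p. 1 - fps_const (?z s) * ?X) oo ?T) (- k)"
    unfolding e_def by (rule fps_rpow_compose[OF pr0]) auto
  also have "(\<Prod>s = 1..p. 1 - fps_const (?z s) * ?X) oo ?T = (\<Prod>s = 1..p. 1 - fps_const (?z s) * ?T)"
    by (simp add: fps_compose_prod_distrib fps_compose_sub_distrib fps_compose_mult_distrib)
  finally have eT: "e oo ?T = fps_rpow (\<Prod>s = 1..p. 1 - fps_const (?z s) * ?T) (- k)" .
  have factor: "(1 - fps_const (?z s) * ?T) * (1 + ?X)\<^sup>2 =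
      1 - fps_const (2 * cos (2 * \<phi> + 2 * pi * real s / real p)) * ?X + ?X\<^sup>2" for s
  proof -
    have "cos (2 * (\<phi> + real s * pi / real p)) = 2 * ?z s - 1"
      by (rule cos_double_cos)
    then have c: "2 * cos (2 * \<phi> + 2 * pi * real s / real p) = 4 * ?z s - 2"
      by (simp add: algebra_simps)
    have "(1 - fps_const (?z s) * ?T) * (1 + ?X)\<^sup>2 = (1 + ?X)\<^sup>2 - fps_const (?z s) * (?T * (1 + ?X)\<^sup>2)"
      by (simp add: algebra_simps)
    also have "\<dots> = 1 - (fps_const (?z s) * 4 - 2) * ?X + ?X\<^sup>2"
      unfolding quad_subst_times by (simp add: algebra_simps power2_eq_square)
    also have "fps_const (?z s) * 4 - 2 = fps_const (4 * ?z s - 2)"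
      by (simp add: numeral_fps_const mult.commute)
    finally show ?thesis unfolding c .
  qed
  \<comment> \<open>Clearing denominators costs one (1 + X)^2 per factor; raised to the power -k and
    moved to the other side, these give the exponent 2pk.\<close>
  have "(\<Prod>s = 1..p. 1 - fps_const (?z s) * ?T) * (1 + ?X) ^ (2 * p) =
      (\<Prod>s = 1..p. (1 - fps_const (?z s) * ?T) * (1 + ?X)\<^sup>2)"
    by (simp add: prod.distrib power_mult)
  also have "\<dots> = 1 - fps_const (2 * cos (real p * (2 * \<phi>))) * ?X ^ p + (?X ^ p)\<^sup>2"
    unfolding factor by (rule prod_fps_quadratic_cos[OF assms(1)])
  also have "\<dots> = Q oo (?X ^ p)"
    using X0 by (simp add: Q_def fps_compose_add_distrib fps_compose_sub_distrib fps_compose_mult_distrib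
        fps_compose_power[symmetric] mult_ac)
  finally have "fps_rpow ((\<Prod>s = 1..p. 1 - fps_const (?z s) * ?T) * (1 + ?X) ^ (2 * p)) (- k) = fps_rpow (Q oo (?X ^ p)) (- k)"
    by simp
  moreover have "((1 + ?X) ^ (2 * p)) $ 0 = 1"
    by (simp add: fps_power_zeroth)
  ultimately have "(e oo ?T) * fps_rpow ((1 + ?X) ^ (2 * p)) (- k) = fps_rpow (Q oo (?X ^ p)) (- k)"
    by (simp add: fps_rpow_mult pr0 eT)
  also have "fps_rpow ((1 + ?X) ^ (2 * p)) (- k) = fps_binomial (- (2 * real p * k))"
    by (simp add: fps_rpow_power fps_rpow_one_plus_X)
  also have "fps_rpow (Q oo (?X ^ p)) (- k) = fps_rpow Q (- k) oo (?X ^ p)"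
    using X0 by (intro fps_rpow_compose[symmetric]) (simp_all add: Q_def)
  also have "fps_rpow Q (- k) = Abs_fps (\<lambda>j. gegenbauer j k ?x)"
    using assms by (simp add: fps_eq_iff Q_def gegenbauer_generating_function)
  finally have eq: "(e oo ?T) * fps_binomial (- (2 * real p * k)) = Abs_fps (\<lambda>j. gegenbauer j k ?x) oo (?X ^ p)" .
  have "fps_binomial (- (2 * real p * k)) * fps_binomial (2 * real p * k) = (1 :: real fps)"
    by (simp flip: fps_binomial_add_mult)
  then have "e oo ?T = fps_binomial (2 * real p * k) * ((e oo ?T) * fps_binomial (- (2 * real p * k)))"
    by (simp add: mult_ac)
  then show ?thesis
    unfolding eq unfolding e_def .
qed

lemma le_of_pos_mult_le:
  fixes p j m :: nat
  assumes "0 < p" "p * j \<le> m"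
  shows "j \<le> m"
proof -
  have "j \<le> p * j" using assms(1) by simp
  also have "\<dots> \<le> m" by fact
  finally show ?thesis .
qed

text \<open>Both sides are compared after composition with \<open>quad_subst\<close>, which is
  injective. There the \<open>j\<close>-th summand becomes C_j X^(pj) (1 + X)^(2pk): the division by
  4^(pj) removes the leading coefficient of the power of the substitution, and the parameter p(j +
  k) compensates its factor (1 + X)^(-2pj).\<close>

lemma dihedral_coeff:
  assumes p: "0 < p" and k: "0 < k"
  shows "fps_rpow (\<Prod>s = 1..p. 1 - fps_const ((cos (\<phi> + real s * pi / real p))\<^sup>2) * fps_X) (- k) $ m =
    (\<Sum>j | p * j \<le> m. gegenbauer j k (cos (2 * real p * \<phi>)) / 4 ^ (p * j) *
       quad_hypergeo (real p * (real j + k)) $ (m - p * j))"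
    (is "?e $ m = ?e' m")
proof -
  let ?T = quad_subst and ?X = "fps_X :: real fps"
  let ?C = "\<lambda>j. gegenbauer j k (cos (2 * real p * \<phi>))"
  let ?H = "\<lambda>j. quad_hypergeo (real p * (real j + k))"
  let ?B = "fps_binomial (2 * real p * k) :: real fps"
  \<comment> \<open>A finite truncation stands in for the infinite sum of series. Since p is
    positive and the substitution has no constant term, the coefficient of index \<open>n\<close>
    after composition involves only \<open>j \<le> n\<close>.\<close>
  define S where "S n = (\<Sum>j\<le>n. fps_const (?C j / 4 ^ (p * j)) * ?X ^ (p * j) * ?H j)" for n
  have S_nth: "S n $ i = ?e' i" if "i \<le> n" for n i
  proof -
    have "p * j \<le> i \<Longrightarrow> j \<le> n" for j
      using le_of_pos_mult_le[OF p] that le_trans by blast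
    then have sub: "{j. p * j \<le> i} \<subseteq> {..n}" by auto
    have "S n $ i = (\<Sum>j\<le>n. if p * j \<le> i then ?C j / 4 ^ (p * j) * ?H j $ (i - p * j) else 0)"
      unfolding S_def fps_sum_nth mult.assoc by (intro sum.cong refl) (simp add: fps_X_power_mult_nth)
    also have "\<dots> = ?e' i"
      using sub by (subst sum.inter_filter[symmetric]) (auto intro!: sum.cong)
    finally show ?thesis .
  qed
  have T_pow: "?T ^ i = fps_const (4 ^ i) * ?X ^ i * fps_binomial (- 2 * real i)" for i
    by (simp add: quad_subst_def power_mult_distrib fps_binomial_power numeral_fps_const fps_const_power mult.commute)
  have S_comp: "S n oo ?T = ?B * (\<Sum>j\<le>n. fps_const (?C j) * ?X ^ (p * j))" for n
  proof -
    have "(fps_const (?C j / 4 ^ (p * j)) * ?X ^ (p * j) * ?H j) oo ?T = ?B * (fps_const (?C j) * ?X ^ (p * j))" for j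
    proof -
      have "0 < real p * (real j + k)" using p k by simp
      then have "(fps_const (?C j / 4 ^ (p * j)) * ?X ^ (p * j) * ?H j) oo ?T =
          fps_const (?C j / 4 ^ (p * j)) * ?T ^ (p * j) * fps_binomial (2 * (real p * (real j + k)))"
        by (simp add: fps_compose_mult_distrib fps_compose_power[symmetric] quad_hypergeo_compose)
      also have "\<dots> = (fps_const (?C j / 4 ^ (p * j)) * fps_const (4 ^ (p * j))) * ?X ^ (p * j) *
          (fps_binomial (- 2 * real (p * j)) * fps_binomial (2 * (real p * (real j + k))))"
        unfolding T_pow by (simp only: mult_ac)
      also have "fps_const (?C j / 4 ^ (p * j)) * fps_const (4 ^ (p * j)) = fps_const (?C j)"
        by simp
      also have "fps_binomial (- 2 * real (p * j)) * fps_binomial (2 * (real p * (real j + k))) = ?B"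
        by (simp add: algebra_simps flip: fps_binomial_add_mult)
      finally show ?thesis by (simp only: mult_ac)
    qed
    then show ?thesis
      by (simp add: S_def fps_compose_sum_distrib sum_distrib_left)
  qed
  have "(Abs_fps ?e' oo ?T) $ n = (?e oo ?T) $ n" for n
  proof -
    have "(Abs_fps ?e' oo ?T) $ n = (S n oo ?T) $ n"
      by (simp add: fps_compose_nth S_nth)
    also have "\<dots> = (?B * (Abs_fps ?C oo ?X ^ p)) $ n"
      unfolding S_comp fps_mult_nth
    proof (intro sum.cong refl arg_cong2[where f = "(*)"])
      fix i assume "i \<in> {0..n}"
      then have "n - i \<le> n" by simp
      moreover have "p * j \<le> i \<Longrightarrow> j \<le> i" for i j
        by (rule le_of_pos_mult_le[OF p])
      ultimately show "(\<Sum>j\<le>n. fps_const (?C j) * ?X ^ (p * j)) $ (n - i) = (Abs_fps ?C oo ?X ^ p) $ (n - i)"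
        unfolding fps_sum_nth fps_compose_nth atLeast0AtMost
        by (intro sum.mono_neutral_cong_right) (auto simp: fps_X_power_nth power_mult[symmetric])
    qed
    also have "\<dots> = (?e oo ?T) $ n"
      by (simp only: dihedral_compose_quad_subst[OF p k])
    finally show ?thesis .
  qed
  then have "Abs_fps ?e' oo ?T = ?e oo ?T"
    by (simp add: fps_eq_iff)
  then have "Abs_fps ?e' = ?e"
    by (subst (asm) fps_compose_inj_right) (simp_all add: quad_subst_nth_1)
  then have "Abs_fps ?e' $ m = ?e $ m"
    by (rule arg_cong)
  then show ?thesis
    by simp
qed

section \<open>Dirichlet integrals\<close>

lemma Gamma_add_of_nat:
  fixes a :: real
  assumes "0 < a"
  shows "Gamma (a + real n) = Gamma a * pochhammer a n"
proof -
  have "a \<notin> \<int>\<^sub>\<le>\<^sub>0" using assms by (auto elim!: nonpos_Ints_cases)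
  then show ?thesis
    using pochhammer_Gamma[of a n] Gamma_real_pos[OF assms] by simp
qed

text \<open>The substitution y = x t reduces this to the Beta integral on the unit interval. At
  \<open>x = 0\<close> both sides vanish, by the convention that \<open>powr\<close> with base 0 is
  0.\<close>

lemma nn_integral_Beta_scaled:
  assumes a: "0 < a" and b: "0 < b" and x: "0 \<le> x"
  shows "(\<integral>\<^sup>+ y. ennreal (indicator {0..x} y * (y powr (a - 1) * (x - y) powr (b - 1))) \<partial>lborel) =
    ennreal (Beta a b * x powr (a + b - 1))"
proof (cases "x = 0")
  case True
  have zero: "indicator {0..x} y * (y powr (a - 1) * (x - y) powr (b - 1)) = 0" for y
    using True by (cases "y = 0") (auto simp: indicator_def)
  show ?thesis
    unfolding zero using True by simp
next
  case False
  with x have x: "0 < x" by simp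
  let ?f = "\<lambda>t::real. t powr (a - 1) * (1 - t) powr (b - 1)"
  have Beta: "(\<integral>\<^sup>+ t. ennreal (indicator {0..1} t * ?f t) \<partial>lborel) = ennreal (Beta a b)"
    using nn_integral_has_integral_lebesgue[OF _ has_integral_Beta_real[OF a b]] by simp
  have "(\<integral>\<^sup>+ y. ennreal (indicator {0..x} y * (y powr (a - 1) * (x - y) powr (b - 1))) \<partial>lborel) =
      ennreal x * (\<integral>\<^sup>+ t. ennreal (indicator {0..x} (0 + x * t) * ((0 + x * t) powr (a - 1) * (x - (0 + x * t)) powr (b - 1))) \<partial>lborel)"
    using x by (subst nn_integral_real_affine[where c = x and t = 0]) simp_all
  also have "\<dots> = ennreal x * (\<integral>\<^sup>+ t. ennreal (x powr (a + b - 2)) * ennreal (indicator {0..1} t * ?f t) \<partial>lborel)"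
  proof (intro arg_cong2[where f = "(*)"] refl nn_integral_cong)
    fix t :: real
    show "ennreal (indicator {0..x} (0 + x * t) * ((0 + x * t) powr (a - 1) * (x - (0 + x * t)) powr (b - 1))) =
        ennreal (x powr (a + b - 2)) * ennreal (indicator {0..1} t * ?f t)"
    proof (cases "t \<in> {0..1}")
      case True
      have "x - x * t = x * (1 - t)" by (simp add: algebra_simps)
      moreover have "x * t \<le> x" using True x by simp
      moreover have "x powr (a + b - 2) = x powr (a - 1) * x powr (b - 1)"
        by (simp flip: powr_add)
      ultimately show ?thesis
        using True x by (simp add: powr_mult mult_ac flip: ennreal_mult)
    next
      case False
      then have "x * t \<notin> {0..x}" using x by (auto simp: zero_le_mult_iff)
      then show ?thesis using False by simp
    qed
  qed
  also have "\<dots> = ennreal x * (ennreal (x powr (a + b - 2)) * ennreal (Beta a b))"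
    by (subst nn_integral_cmult) (simp_all add: Beta)
  also have "\<dots> = ennreal (Beta a b * x powr (a + b - 1))"
  proof -
    have "x * x powr (a + b - 2) = x powr (a + b - 1)"
      using x powr_add[of x 1 "a + b - 2"] by simp
    moreover have "0 \<le> Beta a b" using a b by (simp add: Beta_def)
    ultimately show ?thesis using x by (simp add: mult_ac flip: ennreal_mult)
  qed
  finally show ?thesis .
qed

lemma fps_mult_nonneg:
  fixes f g :: "real fps"
  assumes "\<And>n. 0 \<le> f $ n" "\<And>n. 0 \<le> g $ n"
  shows "0 \<le> (f * g) $ n"
  unfolding fps_mult_nth using assms by (intro sum_nonneg mult_nonneg_nonneg) auto

lemma fps_rpow_linear_nonneg:
  assumes "0 \<le> z" "0 < k"
  shows "0 \<le> fps_rpow (1 - fps_const z * fps_X) (- k) $ n"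
  unfolding fps_rpow_linear_nth using assms by (intro mult_nonneg_nonneg divide_nonneg_nonneg pochhammer_nonneg) auto

lemma fps_rpow_prod_linear_nonneg:
  assumes "\<And>i. i \<in> I \<Longrightarrow> 0 \<le> z i" "0 < k"
  shows "0 \<le> (\<Prod>i\<in>I. fps_rpow (1 - fps_const (z i) * fps_X) (- k)) $ n"
  using assms
proof (induction I arbitrary: n rule: infinite_finite_induct)
  case (insert i I)
  then show ?case
    by (simp add: fps_mult_nonneg fps_rpow_linear_nonneg)
qed (auto simp: fps_one_nth)

lemma ennreal_sum_mult:
  assumes "\<And>l. l \<in> S \<Longrightarrow> 0 \<le> f l" "\<And>l. l \<in> S \<Longrightarrow> 0 \<le> g l"
  shows "ennreal (\<Sum>l\<in>S. f l * g l) = (\<Sum>l\<in>S. ennreal (f l) * ennreal (g l))"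
  using assms by (subst sum_ennreal[symmetric]) (auto simp: ennreal_mult)

text \<open>Each simplex of total mass \<open>x\<close> is sliced along one coordinate, whose factor is integrated last.\<close>

lemma nn_integral_dirichlet:
  fixes z :: "'i \<Rightarrow> real"
  assumes "finite I" "\<And>i. i \<in> I \<Longrightarrow> 0 \<le> z i" "0 < k" "0 \<le> w" "0 \<le> x"
  shows "(\<integral>\<^sup>+ u. ennreal (if (\<forall>i\<in>I. 0 \<le> u i) \<and> sum u I \<le> x then
        (\<Prod>i\<in>I. u i powr (k - 1)) * (x - sum u I) powr (k - 1) * ((\<Sum>i\<in>I. u i * z i) + (x - sum u I) * w) ^ m else 0)
        \<partial>Pi\<^sub>M I (\<lambda>_. lborel)) =
     ennreal (fact m * Gamma k ^ (card I + 1) / Gamma (real (card I + 1) * k + real m) *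
       x powr (real (card I + 1) * k + real m - 1) *
       ((\<Prod>i\<in>I. fps_rpow (1 - fps_const (z i) * fps_X) (- k)) * fps_rpow (1 - fps_const w * fps_X) (- k)) $ m)"
  using assms
proof (induction I arbitrary: x m rule: finite_induct)
  \<comment> \<open>Only the dependent coordinate is left, with value \<open>x\<close> and weight
    \<open>w\<close>; the empty product measure is a unit point mass.\<close>
  case empty
  have "0 < k" using empty.prems by simp
  then have "Gamma (k + real m) = Gamma k * pochhammer k m"
    by (rule Gamma_add_of_nat)
  moreover have "Gamma k \<noteq> 0"
    using Gamma_real_pos[OF \<open>0 < k\<close>] by simp
  moreover have "x powr (k - 1) * x ^ m = x powr (k + real m - 1)"
    using empty.prems powr_realpow[of x m] powr_add[of x "k - 1" "real m"]
    by (cases "x = 0") (auto simp: algebra_simps)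
  ultimately show ?case
    unfolding prod.empty mult_1 fps_rpow_linear_nth using empty.prems \<open>0 < k\<close> pochhammer_pos[of k m] Gamma_real_pos[of k]
    by (simp add: PiM_empty nn_integral_count_space_finite power_mult_distrib mult_ac)
next
  case (insert i I)
  interpret product_sigma_finite "\<lambda>_ :: 'i. lborel :: real measure" by standard
  define F where "F J x m u = (if (\<forall>i\<in>J. 0 \<le> u i) \<and> sum u J \<le> x then
        (\<Prod>i\<in>J. u i powr (k - 1)) * (x - sum u J) powr (k - 1) * ((\<Sum>i\<in>J. u i * z i) + (x - sum u J) * w) ^ m else 0)"
    for J x m and u :: "'i \<Rightarrow> real"
  define e where "e = (\<Prod>i\<in>I. fps_rpow (1 - fps_const (z i) * fps_X) (- k)) * fps_rpow (1 - fps_const w * fps_X) (- k)"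
  define n where "n = real (card I + 1)"
  have z: "0 \<le> z j" if "j \<in> insert i I" for j using insert.prems that by auto
  have k: "0 < k" and w: "0 \<le> w" using insert.prems by auto
  have n: "1 \<le> n" by (simp add: n_def)
  have nk: "0 < n * k + real q" for q using n k by (intro add_pos_nonneg) auto
  have e_nonneg: "0 \<le> e $ q" for q
    unfolding e_def using z k w by (intro fps_mult_nonneg fps_rpow_prod_linear_nonneg fps_rpow_linear_nonneg) auto
  have F_nonneg: "0 \<le> F J x m u" if "J \<subseteq> insert i I" for J x m u
    unfolding F_def using that z w
    by (auto intro!: mult_nonneg_nonneg prod_nonneg sum_nonneg zero_le_power add_nonneg_nonneg)
  have F_meas [measurable]: "F J x m \<in> borel_measurable (Pi\<^sub>M J (\<lambda>_. lborel))" if "finite J" for J x m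
    unfolding F_def using that by measurable
  define A where "A l = real (m choose l) * z i ^ l" for l
  have A_nonneg: "0 \<le> A l" for l using z by (simp add: A_def)
  have IH: "(\<integral>\<^sup>+ u. ennreal (F I y q u) \<partial>Pi\<^sub>M I (\<lambda>_. lborel)) =
      ennreal (fact q * Gamma k ^ (card I + 1) / Gamma (n * k + real q) * y powr (n * k + real q - 1) * e $ q)"
    if "0 \<le> y" for y q
    unfolding F_def e_def n_def using insert.IH[of y q] z k w that by simp
  \<comment> \<open>The binomial theorem separates the sliced coordinate \<open>y\<close>, and what
    remains is an integrand of the same kind on a simplex of mass \<open>x - y\<close> with a
    smaller exponent. This is why the induction keeps \<open>x\<close> and \<open>m\<close>
    arbitrary.\<close>
  have split: "F (insert i I) x m (u(i := y)) =
      (\<Sum>l\<le>m. (indicator {0..x} y * y powr (k + real l - 1) * A l) * F I (x - y) (m - l) u)" for u y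
  proof -
    let ?C = "0 \<le> y \<and> (\<forall>i\<in>I. 0 \<le> u i) \<and> y + sum u I \<le> x"
    let ?R = "(\<Sum>j\<in>I. u j * z j) + (x - y - sum u I) * w"
    have u: "(u(i := y)) j = u j" if "j \<in> I" for j using that insert.hyps by auto
    have upd: "sum (u(i := y)) (insert i I) = y + sum u I"
      "(\<Sum>j\<in>insert i I. (u(i := y)) j * z j) = y * z i + (\<Sum>j\<in>I. u j * z j)"
      "(\<Prod>j\<in>insert i I. (u(i := y)) j powr (k - 1)) = y powr (k - 1) * (\<Prod>j\<in>I. u j powr (k - 1))"
      "(\<forall>j\<in>insert i I. 0 \<le> (u(i := y)) j) \<longleftrightarrow> 0 \<le> y \<and> (\<forall>j\<in>I. 0 \<le> u j)"
      using insert.hyps by (simp_all add: u fun_upd_same del: fun_upd_apply cong: sum.cong prod.cong)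
    have "F (insert i I) x m (u(i := y)) = (if ?C then
        y powr (k - 1) * (\<Prod>j\<in>I. u j powr (k - 1)) * (x - y - sum u I) powr (k - 1) * (y * z i + ?R) ^ m else 0)"
      unfolding F_def upd by (simp add: diff_diff_add add.assoc)
    also have "(y * z i + ?R) ^ m = (\<Sum>l\<le>m. real (m choose l) * (y * z i) ^ l * ?R ^ (m - l))"
      by (rule binomial_ring)
    also have "(if ?C then y powr (k - 1) * (\<Prod>j\<in>I. u j powr (k - 1)) * (x - y - sum u I) powr (k - 1) *
          (\<Sum>l\<le>m. real (m choose l) * (y * z i) ^ l * ?R ^ (m - l)) else 0) =
        (\<Sum>l\<le>m. (indicator {0..x} y * y powr (k + real l - 1) * A l) * F I (x - y) (m - l) u)"
    proof (cases ?C)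
      case True
      have "0 \<le> sum u I" using True by (intro sum_nonneg) auto
      then have yx: "y \<in> {0..x}" using True by auto
      have C: "(\<forall>i\<in>I. 0 \<le> u i) \<and> sum u I \<le> x - y" using True by auto
      have pow: "y powr (k + real l - 1) = y powr (k - 1) * y ^ l" for l
        using True powr_realpow[of y l] powr_add[of y "k - 1" "real l"]
        by (cases "y = 0") (auto simp: algebra_simps)
      show ?thesis
        unfolding F_def if_P[OF True] if_P[OF C] sum_distrib_left pow
        using yx by (intro sum.cong refl) (simp add: A_def power_mult_distrib)
    next
      case False
      then have "(indicator {0..x} y * y powr (k + real l - 1) * A l) * F I (x - y) (m - l) u = 0" for l
        by (auto simp: F_def indicator_def)
      then show ?thesis
        unfolding if_not_P[OF False] by (simp only: sum.neutral_const)
    qed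
    finally show ?thesis .
  qed
  have "(\<integral>\<^sup>+ u. ennreal (F (insert i I) x m u) \<partial>Pi\<^sub>M (insert i I) (\<lambda>_. lborel)) =
     (\<integral>\<^sup>+ y. (\<integral>\<^sup>+ u. ennreal (F (insert i I) x m (u(i := y))) \<partial>Pi\<^sub>M I (\<lambda>_. lborel)) \<partial>lborel)"
    using insert.hyps F_meas[of "insert i I" x m] by (intro product_nn_integral_insert_rev) auto
  also have "\<dots> = (\<integral>\<^sup>+ y. (\<Sum>l\<le>m. ennreal (A l * (fact (m - l) * Gamma k ^ (card I + 1) / Gamma (n * k + real (m - l)) * e $ (m - l))) *
      ennreal (indicator {0..x} y * (y powr (k + real l - 1) * (x - y) powr (n * k + real (m - l) - 1)))) \<partial>lborel)"
  proof (intro nn_integral_cong)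
    fix y :: real
    have "(\<integral>\<^sup>+ u. ennreal (F (insert i I) x m (u(i := y))) \<partial>Pi\<^sub>M I (\<lambda>_. lborel)) =
        (\<integral>\<^sup>+ u. (\<Sum>l\<le>m. ennreal (indicator {0..x} y * y powr (k + real l - 1) * A l) * ennreal (F I (x - y) (m - l) u)) \<partial>Pi\<^sub>M I (\<lambda>_. lborel))"
      unfolding split using A_nonneg F_nonneg[of I]
      by (intro nn_integral_cong ennreal_sum_mult) auto
    also have "\<dots> = (\<Sum>l\<le>m. ennreal (indicator {0..x} y * y powr (k + real l - 1) * A l) * (\<integral>\<^sup>+ u. ennreal (F I (x - y) (m - l) u) \<partial>Pi\<^sub>M I (\<lambda>_. lborel)))"
      using insert.hyps F_meas[of I] by (subst nn_integral_sum) (auto intro!: sum.cong nn_integral_cmult)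
    also have "\<dots> = (\<Sum>l\<le>m. ennreal (A l * (fact (m - l) * Gamma k ^ (card I + 1) / Gamma (n * k + real (m - l)) * e $ (m - l))) *
      ennreal (indicator {0..x} y * (y powr (k + real l - 1) * (x - y) powr (n * k + real (m - l) - 1))))"
    proof (intro sum.cong refl)
      fix l
      have "0 < Gamma (n * k + real (m - l))" "0 < Gamma k"
        using nk k by (auto intro!: Gamma_real_pos)
      then show "ennreal (indicator {0..x} y * y powr (k + real l - 1) * A l) * (\<integral>\<^sup>+ u. ennreal (F I (x - y) (m - l) u) \<partial>Pi\<^sub>M I (\<lambda>_. lborel)) =
        ennreal (A l * (fact (m - l) * Gamma k ^ (card I + 1) / Gamma (n * k + real (m - l)) * e $ (m - l))) *
        ennreal (indicator {0..x} y * (y powr (k + real l - 1) * (x - y) powr (n * k + real (m - l) - 1)))"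
        using IH[of "x - y" "m - l"] A_nonneg[of l] e_nonneg[of "m - l"]
        by (cases "y \<in> {0..x}") (auto simp: ennreal_mult[symmetric] mult_ac)
    qed
    finally show "(\<integral>\<^sup>+ u. ennreal (F (insert i I) x m (u(i := y))) \<partial>Pi\<^sub>M I (\<lambda>_. lborel)) = \<dots>" .
  qed
  also have "\<dots> = (\<Sum>l\<le>m. ennreal (A l * (fact (m - l) * Gamma k ^ (card I + 1) / Gamma (n * k + real (m - l)) * e $ (m - l))) *
      ennreal (Beta (k + real l) (n * k + real (m - l)) * x powr (k + real l + (n * k + real (m - l)) - 1)))"
  proof (subst nn_integral_sum)
    have "0 < k + real l" for l using k by simp
    then show "(\<Sum>l\<le>m. \<integral>\<^sup>+ y. ennreal (A l * (fact (m - l) * Gamma k ^ (card I + 1) / Gamma (n * k + real (m - l)) * e $ (m - l))) *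
        ennreal (indicator {0..x} y * (y powr (k + real l - 1) * (x - y) powr (n * k + real (m - l) - 1))) \<partial>lborel) =
      (\<Sum>l\<le>m. ennreal (A l * (fact (m - l) * Gamma k ^ (card I + 1) / Gamma (n * k + real (m - l)) * e $ (m - l))) *
        ennreal (Beta (k + real l) (n * k + real (m - l)) * x powr (k + real l + (n * k + real (m - l)) - 1)))"
      using nk insert.prems
      by (intro sum.cong refl, subst nn_integral_cmult) (simp_all only: nn_integral_Beta_scaled, simp)
  qed simp
  \<comment> \<open>The Gamma value in the denominator of the induction hypothesis cancels against
    the Beta function, and (k)_l / l! times z^l is a coefficient of (1 - zX)^(-k). The sum over
    \<open>l\<close> is therefore a Cauchy product.\<close>
  also have "\<dots> = (\<Sum>l\<le>m. ennreal (fact m * Gamma k ^ (card I + 2) / Gamma ((n + 1) * k + real m) * x powr ((n + 1) * k + real m - 1) *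
      (pochhammer k l / fact l * z i ^ l * e $ (m - l))))"
  proof (intro sum.cong refl)
    fix l assume "l \<in> {..m}"
    then have l: "l \<le> m" by simp
    have pos: "0 < Gamma (n * k + real (m - l))" "0 < Gamma k" "0 < Gamma (k + real l)" "0 < Gamma ((n + 1) * k + real m)"
      using nk k n by (auto intro!: Gamma_real_pos add_pos_nonneg)
    have sum: "k + real l + (n * k + real (m - l)) = (n + 1) * k + real m"
      using l by (simp add: of_nat_diff algebra_simps)
    have G: "Gamma (k + real l) = Gamma k * pochhammer k l"
      by (rule Gamma_add_of_nat[OF k])
    have ch: "real (m choose l) * fact (m - l) = fact m / fact l"
      using l by (simp add: binomial_fact)
    have "A l * (fact (m - l) * Gamma k ^ (card I + 1) / Gamma (n * k + real (m - l)) * e $ (m - l)) *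
       (Beta (k + real l) (n * k + real (m - l)) * x powr (k + real l + (n * k + real (m - l)) - 1)) =
       (real (m choose l) * fact (m - l)) * z i ^ l * Gamma k ^ (card I + 1) * e $ (m - l) *
         (Gamma (k + real l) / Gamma ((n + 1) * k + real m) * x powr ((n + 1) * k + real m - 1))"
      unfolding Beta_def sum using pos by (simp add: A_def)
    also have "\<dots> = fact m * Gamma k ^ (card I + 2) / Gamma ((n + 1) * k + real m) * x powr ((n + 1) * k + real m - 1) *
      (pochhammer k l / fact l * z i ^ l * e $ (m - l))"
      unfolding ch G by (simp add: mult_ac)
    finally have eq: "A l * (fact (m - l) * Gamma k ^ (card I + 1) / Gamma (n * k + real (m - l)) * e $ (m - l)) *
       (Beta (k + real l) (n * k + real (m - l)) * x powr (k + real l + (n * k + real (m - l)) - 1)) = \<dots>" .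
    show "ennreal (A l * (fact (m - l) * Gamma k ^ (card I + 1) / Gamma (n * k + real (m - l)) * e $ (m - l))) *
      ennreal (Beta (k + real l) (n * k + real (m - l)) * x powr (k + real l + (n * k + real (m - l)) - 1)) =
      ennreal (fact m * Gamma k ^ (card I + 2) / Gamma ((n + 1) * k + real m) * x powr ((n + 1) * k + real m - 1) *
      (pochhammer k l / fact l * z i ^ l * e $ (m - l)))"
      unfolding eq[symmetric] using pos A_nonneg e_nonneg by (intro ennreal_mult'[symmetric]) auto
  qed
  also have "\<dots> = ennreal (\<Sum>l\<le>m. fact m * Gamma k ^ (card I + 2) / Gamma ((n + 1) * k + real m) * x powr ((n + 1) * k + real m - 1) *
      (pochhammer k l / fact l * z i ^ l * e $ (m - l)))"
    using k n z e_nonneg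
    by (intro sum_ennreal mult_nonneg_nonneg divide_nonneg_nonneg pochhammer_nonneg zero_le_power less_imp_le[OF Gamma_real_pos] add_pos_nonneg)
      auto
  also have "(\<Sum>l\<le>m. fact m * Gamma k ^ (card I + 2) / Gamma ((n + 1) * k + real m) * x powr ((n + 1) * k + real m - 1) *
      (pochhammer k l / fact l * z i ^ l * e $ (m - l))) =
      fact m * Gamma k ^ (card I + 2) / Gamma ((n + 1) * k + real m) * x powr ((n + 1) * k + real m - 1) *
      (fps_rpow (1 - fps_const (z i) * fps_X) (- k) * e) $ m"
    by (simp add: sum_distrib_left fps_mult_nth fps_rpow_linear_nth atLeast0AtMost)
  finally show ?case
    using insert.hyps by (simp add: F_def e_def n_def mult.assoc add_ac)
qed

text \<open>With \<open>c\<close> and \<open>z\<close> nonnegative, sum and integral are exchanged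
  in the extended nonnegative reals, so no dominating function is sought for an integrand that may
  be singular on the boundary. Convergence to \<open>S\<close> then makes the value finite.\<close>

lemma simplex_integral_power_series:
  fixes z :: "nat \<Rightarrow> real"
  assumes p: "1 \<le> p" and k: "0 < k" and z: "\<And>s. 0 \<le> z s" and c: "\<And>m. 0 \<le> c m"
    and conv: "\<And>x. 0 \<le> x \<Longrightarrow> summable (\<lambda>m. c m * x ^ m)"
    and S: "(\<lambda>m. c m * (fact m * Gamma k ^ p / Gamma (real p * k + real m) *
      fps_rpow (\<Prod>s = 1..p. 1 - fps_const (z s) * fps_X) (- k) $ m)) sums S"
  shows "simplex_integral p (\<lambda>u. (\<Prod>s = 1..p. u s powr (k - 1)) * (\<Sum>m. c m * (\<Sum>s = 1..p. u s * z s) ^ m)) = S"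
proof -
  let ?I = "{1..<p}"
  let ?M = "Pi\<^sub>M ?I (\<lambda>_. lborel) :: (nat \<Rightarrow> real) measure"
  let ?D = "\<lambda>m. fact m * Gamma k ^ p / Gamma (real p * k + real m) *
      fps_rpow (\<Prod>s = 1..p. 1 - fps_const (z s) * fps_X) (- k) $ m"
  have Icc: "{1..p} = insert p ?I" using p by auto
  define C where "C u \<longleftrightarrow> (\<forall>i\<in>?I. 0 \<le> u i) \<and> sum u ?I \<le> 1" for u :: "nat \<Rightarrow> real"
  define V where "V u = (\<Prod>i\<in>?I. u i powr (k - 1)) * (1 - sum u ?I) powr (k - 1)" for u :: "nat \<Rightarrow> real"
  define Y where "Y u = (\<Sum>i\<in>?I. u i * z i) + (1 - sum u ?I) * z p" for u :: "nat \<Rightarrow> real"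
  define W where "W m u = (if C u then V u * Y u ^ m else 0)" for m u
  have [measurable]: "Measurable.pred ?M C" unfolding C_def by measurable
  have [measurable]: "V \<in> borel_measurable ?M" unfolding V_def by measurable
  have [measurable]: "Y \<in> borel_measurable ?M" unfolding Y_def by measurable
  have [measurable]: "W m \<in> borel_measurable ?M" for m unfolding W_def by measurable
  have V_nonneg: "0 \<le> V u" for u by (simp add: V_def prod_nonneg)
  have Y_nonneg: "0 \<le> Y u" if "C u" for u
    using that z by (auto simp: Y_def C_def intro!: add_nonneg_nonneg sum_nonneg mult_nonneg_nonneg)
  have W_nonneg: "0 \<le> W m u" for m u using V_nonneg Y_nonneg by (simp add: W_def)
  have D_nonneg: "0 \<le> ?D m" for m
  proof -
    have "0 \<le> fps_rpow (\<Prod>s = 1..p. 1 - fps_const (z s) * fps_X) (- k) $ m"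
      using z k by (subst fps_rpow_prod) (auto intro!: fps_rpow_prod_linear_nonneg)
    moreover have "0 < Gamma (real p * k + real m)" "0 < Gamma k"
      using p k by (auto intro!: Gamma_real_pos add_pos_nonneg)
    ultimately show ?thesis by simp
  qed
  have W_integral: "(\<integral>\<^sup>+ u. ennreal (W m u) \<partial>?M) = ennreal (?D m)" for m
  proof -
    have "card ?I + 1 = p" using p by simp
    moreover have "fps_rpow (\<Prod>s = 1..p. 1 - fps_const (z s) * fps_X) (- k) =
        (\<Prod>i\<in>?I. fps_rpow (1 - fps_const (z i) * fps_X) (- k)) * fps_rpow (1 - fps_const (z p) * fps_X) (- k)"
      unfolding Icc by (subst fps_rpow_prod) (simp_all add: mult.commute)
    ultimately show ?thesis
      using nn_integral_dirichlet[of ?I z k "z p" 1 m] z k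
      by (simp only: W_def C_def V_def Y_def) simp
  qed
  have conv_W: "summable (\<lambda>m. c m * W m u)" for u
  proof (cases "C u")
    case True
    then have "summable (\<lambda>m. V u * (c m * Y u ^ m))"
      using conv[OF Y_nonneg] by (intro summable_mult) auto
    then show ?thesis using True by (simp add: W_def mult_ac)
  qed (simp add: W_def)
  have "simplex_integral p (\<lambda>u. (\<Prod>s = 1..p. u s powr (k - 1)) * (\<Sum>m. c m * (\<Sum>s = 1..p. u s * z s) ^ m)) =
      (\<integral>u. (\<Sum>m. c m * W m u) \<partial>?M)"
    unfolding simplex_integral_def set_lebesgue_integral_def
  proof (intro Bochner_Integration.integral_cong refl)
    fix u assume u: "u \<in> space ?M"
    let ?u = "u(p := 1 - sum u ?I)"
    have C: "u \<in> simplex_coords p \<longleftrightarrow> C u"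
      using u by (auto simp: simplex_coords_def C_def space_PiM)
    have V: "(\<Prod>s = 1..p. ?u s powr (k - 1)) = V u"
    proof -
      have "(\<Prod>s\<in>insert p ?I. ?u s powr (k - 1)) = ?u p powr (k - 1) * (\<Prod>s\<in>?I. ?u s powr (k - 1))"
        by (rule prod.insert) auto
      also have "(\<Prod>s\<in>?I. ?u s powr (k - 1)) = (\<Prod>s\<in>?I. u s powr (k - 1))"
        by (rule prod.cong) auto
      finally show ?thesis
        unfolding Icc V_def by (simp only: fun_upd_same mult.commute)
    qed
    have Y: "(\<Sum>s = 1..p. ?u s * z s) = Y u"
    proof -
      have "(\<Sum>s\<in>insert p ?I. ?u s * z s) = ?u p * z p + (\<Sum>s\<in>?I. ?u s * z s)"
        by (rule sum.insert) auto
      also have "(\<Sum>s\<in>?I. ?u s * z s) = (\<Sum>s\<in>?I. u s * z s)"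
        by (rule sum.cong) auto
      finally show ?thesis
        unfolding Icc Y_def by (simp only: fun_upd_same add.commute)
    qed
    show "indicat_real (simplex_coords p) u *\<^sub>R ((\<Prod>s = 1..p. ?u s powr (k - 1)) * (\<Sum>m. c m * (\<Sum>s = 1..p. ?u s * z s) ^ m)) =
        (\<Sum>m. c m * W m u)"
    proof (cases "C u")
      case True
      then show ?thesis
        unfolding V Y using suminf_mult[OF conv[OF Y_nonneg[OF True]], of "V u"]
        by (simp add: C W_def mult_ac)
    qed (simp add: C W_def)
  qed
  also have "\<dots> = enn2real (\<integral>\<^sup>+ u. ennreal (\<Sum>m. c m * W m u) \<partial>?M)"
  proof (rule integral_eq_nn_integral)
    show "(\<lambda>u. \<Sum>m. c m * W m u) \<in> borel_measurable ?M" by measurable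
    show "AE u in ?M. 0 \<le> (\<Sum>m. c m * W m u)"
      using c W_nonneg conv_W by (intro AE_I2 suminf_nonneg mult_nonneg_nonneg)
  qed
  also have "(\<integral>\<^sup>+ u. ennreal (\<Sum>m. c m * W m u) \<partial>?M) = (\<integral>\<^sup>+ u. (\<Sum>m. ennreal (c m) * ennreal (W m u)) \<partial>?M)"
    using c W_nonneg conv_W by (intro nn_integral_cong) (simp add: suminf_ennreal2[symmetric] ennreal_mult)
  also have "\<dots> = (\<Sum>m. \<integral>\<^sup>+ u. ennreal (c m) * ennreal (W m u) \<partial>?M)"
    by (rule nn_integral_suminf) measurable
  also have "\<dots> = (\<Sum>m. ennreal (c m) * ennreal (?D m))"
    by (intro suminf_cong, subst nn_integral_cmult) (measurable, simp only: W_integral)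
  also have "\<dots> = (\<Sum>m. ennreal (c m * ?D m))"
    using c D_nonneg by (intro suminf_cong ennreal_mult[symmetric])
  also have "\<dots> = ennreal (\<Sum>m. c m * ?D m)"
    by (intro suminf_ennreal2 mult_nonneg_nonneg[OF c D_nonneg] sums_summable[OF S])
  also have "(\<Sum>m. c m * ?D m) = S"
    using S by (rule sums_unique[symmetric])
  also have "enn2real (ennreal S) = S"
    by (intro enn2real_ennreal sums_le[OF _ sums_zero S] mult_nonneg_nonneg[OF c D_nonneg])
  finally show ?thesis .
qed

section \<open>Bounds for 1F1 and for the Gamma quotients\<close>

lemma pochhammer_le_power_mult:
  fixes a c r :: real
  assumes "0 < a" "0 < c" "1 \<le> r" "a \<le> r * c"
  shows "pochhammer a n \<le> r ^ n * pochhammer c n"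
proof (induction n)
  case (Suc n)
  have "1 * real n \<le> r * real n" using assms by (intro mult_right_mono) auto
  then have "a + real n \<le> r * (c + real n)" using assms by (simp add: distrib_left)
  with Suc have "pochhammer a n * (a + real n) \<le> (r ^ n * pochhammer c n) * (r * (c + real n))"
    using assms by (intro mult_mono) (auto intro!: mult_nonneg_nonneg pochhammer_nonneg less_imp_le[OF pochhammer_pos])
  then show ?case by (simp add: pochhammer_Suc mult_ac)
qed auto

text \<open>The parameter \<open>r\<close> makes room for \<open>a > c\<close>. The functions on the
  left-hand side are treated with \<open>r = 1\<close>; the one under the integral takes
  \<open>r = 2\<close>, because pk + 1/2 can be smaller than p.\<close>

lemma hyp1F1_term_bounds:
  fixes a c r :: real
  assumes "0 < a" "0 < c" "1 \<le> r" "a \<le> r * c" "0 \<le> x"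
  shows "0 \<le> pochhammer a m / pochhammer c m * (x ^ m / fact m)"
    and "pochhammer a m / pochhammer c m * (x ^ m / fact m) \<le> (r * x) ^ m / fact m"
proof -
  have pos: "0 < pochhammer a m" "0 < pochhammer c m" using assms by (auto intro!: pochhammer_pos)
  then show "0 \<le> pochhammer a m / pochhammer c m * (x ^ m / fact m)" using assms by simp
  have "pochhammer a m / pochhammer c m \<le> r ^ m"
    using pochhammer_le_power_mult[of a c r m] assms pos by (simp add: divide_le_eq)
  then have "pochhammer a m / pochhammer c m * (x ^ m / fact m) \<le> r ^ m * (x ^ m / fact m)"
    using assms by (intro mult_right_mono) auto
  then show "pochhammer a m / pochhammer c m * (x ^ m / fact m) \<le> (r * x) ^ m / fact m"
    by (simp add: power_mult_distrib)
qed

lemma summable_exp_real: "summable (\<lambda>m. x ^ m / fact m :: real)"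
  using summable_exp[of x] by (simp add: divide_inverse mult.commute)

lemma hyp1F1_sums:
  assumes "0 < a" "0 < c" "1 \<le> r" "a \<le> r * c" "0 \<le> x"
  shows "(\<lambda>m. pochhammer a m / pochhammer c m * (x ^ m / fact m)) sums hyp1F1 a c x"
proof -
  have "norm (pochhammer a m / pochhammer c m * (x ^ m / fact m)) \<le> (r * x) ^ m / fact m" for m
    using hyp1F1_term_bounds[OF assms, of m] by (simp only: real_norm_def abs_of_nonneg)
  then have "summable (\<lambda>m. pochhammer a m / pochhammer c m * (x ^ m / fact m))"
    by (intro summable_comparison_test'[OF summable_exp_real[of "r * x"]])
  then show ?thesis unfolding hyp1F1_def by (rule summable_sums)
qed

lemma hyp1F1_le_exp:
  assumes "0 < a" "0 < c" "1 \<le> r" "a \<le> r * c" "0 \<le> x"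
  shows "hyp1F1 a c x \<le> exp (r * x)"
proof -
  have "(\<lambda>m. (r * x) ^ m / fact m) sums exp (r * x)"
    using exp_converges[of "r * x"] by (simp add: divide_inverse mult.commute)
  then show "hyp1F1 a c x \<le> exp (r * x)"
    using hyp1F1_term_bounds(2)[OF assms] by (intro sums_le[OF _ hyp1F1_sums[OF assms]])
qed

text \<open>With q = pj the quotient is a constant times (p)_q / (2pk)_(2q), and (p)_q q! \<le>
  (p)_q (p + q)_q = (p)_(2q) \<le> (2pk)_(2q), the last step by 2k > 1. The gained 1/q! absorbs both
  v^(pj) and the bound 3^j.\<close>

lemma Gamma_ratio_le:
  assumes "2 \<le> p" "1 / 2 < k"
  shows "Gamma (real p * (real j + 1)) / Gamma (2 * real p * (real j + k)) \<le>
    Gamma (real p) / Gamma (2 * real p * k) / fact (p * j)"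
proof -
  let ?q = "p * j"
  have p: "1 < real p" using assms by simp
  have kp: "real p \<le> 2 * real p * k" using assms mult_left_mono[of 1 "2 * k" "real p"] by simp
  have G1: "Gamma (real p * (real j + 1)) = Gamma (real p) * pochhammer (real p) ?q"
    using Gamma_add_of_nat[of "real p" ?q] p by (simp add: algebra_simps)
  have G2: "Gamma (2 * real p * (real j + k)) = Gamma (2 * real p * k) * pochhammer (2 * real p * k) (2 * ?q)"
    using Gamma_add_of_nat[of "2 * real p * k" "2 * ?q"] p kp by (simp add: algebra_simps)
  have pos: "0 < Gamma (real p)" "0 < Gamma (2 * real p * k)" "0 < pochhammer (real p) ?q"
    "0 < pochhammer (2 * real p * k) (2 * ?q)"
    using p kp by (auto intro!: Gamma_real_pos pochhammer_pos)
  have "fact ?q = pochhammer 1 ?q" by (simp add: pochhammer_fact)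
  also have "\<dots> \<le> pochhammer (real p + real ?q) ?q"
  proof -
    have "1 \<le> real p + real ?q" using p by linarith
    then show ?thesis using pochhammer_le_power_mult[of 1 "real p + real ?q" 1 ?q] by simp
  qed
  finally have "pochhammer (real p) ?q * fact ?q \<le> pochhammer (real p) ?q * pochhammer (real p + real ?q) ?q"
    using pos by (intro mult_left_mono) auto
  also have "\<dots> = pochhammer (real p) (2 * ?q)"
    using pochhammer_product'[of "real p" ?q ?q] by (simp add: mult_2)
  also have "\<dots> \<le> pochhammer (2 * real p * k) (2 * ?q)"
    using pochhammer_le_power_mult[of "real p" "2 * real p * k" 1 "2 * ?q"] p kp by simp
  finally have le: "pochhammer (real p) ?q * fact ?q \<le> pochhammer (2 * real p * k) (2 * ?q)" .
  have "pochhammer (real p) ?q / pochhammer (2 * real p * k) (2 * ?q) \<le> pochhammer (real p) ?q / (pochhammer (real p) ?q * fact ?q)"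
    using le pos by (intro divide_left_mono) auto
  also have "\<dots> = 1 / fact ?q" using pos by simp
  finally have "Gamma (real p) / Gamma (2 * real p * k) * (pochhammer (real p) ?q / pochhammer (2 * real p * k) (2 * ?q)) \<le>
     Gamma (real p) / Gamma (2 * real p * k) * (1 / fact ?q)"
    using pos by (intro mult_left_mono) auto
  then show ?thesis unfolding G1 G2 by (simp add: mult_ac)
qed

section \<open>The double series\<close>

text \<open>The term of index \<open>n\<close> in the expansion of the \<open>j\<close>-th summand of the left-hand side.\<close>

definition dihedral_term :: "nat \<Rightarrow> real \<Rightarrow> real \<Rightarrow> real \<Rightarrow> nat \<Rightarrow> nat \<Rightarrow> real" where
  "dihedral_term p k v x j n =
     Gamma (real p * (real j + 1)) / Gamma (2 * real p * (real j + k)) * v ^ (p * j) * gegenbauer j k x *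
     (pochhammer (real p * (real j + 1)) n / pochhammer (2 * real p * (real j + k) + 1) n * (v ^ n / fact n))"

text \<open>Two shifted Gamma arguments depend on \<open>m\<close> alone: p(j + 1) + n = p + m and
  2p(j + k) + 2n = 2pk + 2m. Duplication splits (2pk)_(2m) into (pk)_m, which joins Gamma(pk), and
  (pk + 1/2)_m; the surplus 4^(m - n) is the 4^(pj).\<close>

lemma dihedral_term_eq:
  assumes p: "2 \<le> p" and k: "0 < k" and m: "m = p * j + n"
  shows "dihedral_term p k v x j n =
    Gamma (real p) * Gamma (real p * k) / (Gamma k ^ p * Gamma (2 * real p * k)) *
    (pochhammer (real p) m / pochhammer (real p * k + 1 / 2) m * (v ^ m / fact m) *
     (fact m * Gamma k ^ p / Gamma (real p * k + real m) *
      (gegenbauer j k x / 4 ^ (p * j) * quad_hypergeo (real p * (real j + k)) $ n)))"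
proof -
  define a where "a = real p * (real j + k)"
  have p0: "0 < real p" using p by simp
  have pk: "0 < real p * k" and a: "0 < a" using p0 k by (auto simp: a_def)
  have "Gamma (real p * (real j + 1)) * pochhammer (real p * (real j + 1)) n = Gamma (real p * (real j + 1) + real n)"
    using p0 by (intro Gamma_add_of_nat[symmetric]) (simp add: add_pos_pos)
  also have "\<dots> = Gamma (real p + real m)"
    by (simp add: m algebra_simps)
  also have "\<dots> = Gamma (real p) * pochhammer (real p) m"
    by (rule Gamma_add_of_nat[OF p0])
  finally have G1: "Gamma (real p * (real j + 1)) * pochhammer (real p * (real j + 1)) n = Gamma (real p) * pochhammer (real p) m" .
  have "Gamma (2 * real p * k) * pochhammer (2 * real p * k) (2 * m) = Gamma (2 * real p * k + real (2 * m))"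
    using pk by (intro Gamma_add_of_nat[symmetric]) (simp add: mult_ac)
  also have "\<dots> = Gamma (2 * a + real (2 * n))"
    by (simp add: m a_def algebra_simps)
  also have "\<dots> = Gamma (2 * a) * pochhammer (2 * a) (2 * n)"
    using a by (intro Gamma_add_of_nat) simp
  finally have G2: "Gamma (2 * real p * k) * pochhammer (2 * real p * k) (2 * m) = Gamma (2 * a) * pochhammer (2 * a) (2 * n)" .
  have dup: "pochhammer (2 * b) (2 * q) = 4 ^ q * (pochhammer b q * pochhammer (b + 1 / 2) q)" for b :: real and q
    using pochhammer_double[of b q] by (simp add: power_mult)
  have G3: "Gamma (2 * real p * k) * (4 ^ (p * j) * (pochhammer (real p * k) m * pochhammer (real p * k + 1 / 2) m)) =
      Gamma (2 * a) * (pochhammer a n * pochhammer (a + 1 / 2) n)"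
    using G2 dup[of "real p * k" m] dup[of a n] by (simp add: m power_add mult_ac)
  have pos: "0 < Gamma k" "0 < Gamma (real p * k)" "0 < Gamma (2 * real p * k)" "0 < Gamma (2 * a)"
    "0 < pochhammer (real p * k) m" "0 < pochhammer (real p * k + 1 / 2) m" "0 < pochhammer (2 * a + 1) n"
    using k pk a by (auto intro!: Gamma_real_pos pochhammer_pos simp: mult_ac)
  \<comment> \<open>Naming the Pochhammer and Gamma factors leaves an identity between rational
    expressions in opaque variables.\<close>
  define P1 P2 P3 P4 P5 where "P1 = pochhammer (real p * k) m" and "P2 = pochhammer (real p * k + 1 / 2) m"
    and "P3 = pochhammer (2 * a + 1) n" and "P4 = pochhammer a n * pochhammer (a + 1 / 2) n" and "P5 = pochhammer (real p) m"
  define g1 g2 g3 g4 where "g1 = Gamma (real p)" and "g2 = Gamma (real p * k)" and "g3 = Gamma (2 * real p * k)" and "g4 = Gamma (2 * a)"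
  note defs = P1_def P2_def P3_def P4_def P5_def g1_def g2_def g3_def g4_def
  have pos': "P1 \<noteq> 0" "P2 \<noteq> 0" "P3 \<noteq> 0" "g2 \<noteq> 0" "g3 \<noteq> 0" "g4 \<noteq> 0" "Gamma k \<noteq> 0"
    using pos by (auto simp: defs)
  have G3': "P4 = g3 * (4 ^ (p * j) * (P1 * P2)) / g4"
    using G3 pos by (simp add: defs field_simps)
  have "dihedral_term p k v x j n =
      (Gamma (real p * (real j + 1)) * pochhammer (real p * (real j + 1)) n) / Gamma (2 * a) * (v ^ (p * j) * v ^ n) *
      gegenbauer j k x / (P3 * fact n)"
    by (simp add: dihedral_term_def a_def P3_def mult_ac)
  also have "\<dots> = g1 * P5 / g4 * v ^ m * gegenbauer j k x / (P3 * fact n)"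
    unfolding G1 by (simp add: m power_add defs)
  also have "\<dots> = g1 * g2 / (Gamma k ^ p * g3) * (P5 / P2 * (v ^ m / fact m) *
     (fact m * Gamma k ^ p / (g2 * P1) * (gegenbauer j k x / 4 ^ (p * j) * (P4 / (P3 * fact n)))))"
    unfolding G3' using pos' by (simp add: divide_simps)
  also have "\<dots> = Gamma (real p) * Gamma (real p * k) / (Gamma k ^ p * Gamma (2 * real p * k)) *
    (pochhammer (real p) m / pochhammer (real p * k + 1 / 2) m * (v ^ m / fact m) *
     (fact m * Gamma k ^ p / Gamma (real p * k + real m) *
      (gegenbauer j k x / 4 ^ (p * j) * quad_hypergeo (real p * (real j + k)) $ n)))"
    by (simp add: defs quad_hypergeo_def Gamma_add_of_nat[OF pk] a_def)
  finally show ?thesis .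
qed

lemma real_of_nat_shifted_le:
  assumes "2 \<le> p" "1 / 2 < k"
  shows "real p * (real j + 1) \<le> 1 * (2 * real p * (real j + k) + 1)"
proof -
  have "real p * (real j + 1) \<le> real p * (2 * (real j + k))"
    using assms by (intro mult_left_mono) auto
  then show ?thesis by (simp add: mult_ac)
qed

lemma dihedral_term_sums:
  assumes "2 \<le> p" "1 / 2 < k" "0 < v"
  shows "(dihedral_term p k v x j has_sum
    Gamma (real p * (real j + 1)) / Gamma (2 * real p * (real j + k)) * v ^ (p * j) *
    hyp1F1 (real p * (real j + 1)) (2 * real p * (real j + k) + 1) v * gegenbauer j k x) UNIV"
    (is "(_ has_sum ?L) _")
    and "(\<Sum>\<^sub>\<infinity>n. norm (dihedral_term p k v x j n)) \<le>
      Gamma (real p * (real j + 1)) / Gamma (2 * real p * (real j + k)) * v ^ (p * j) * exp v * \<bar>gegenbauer j k x\<bar>"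
    and "(\<lambda>n. norm (dihedral_term p k v x j n)) summable_on UNIV"
proof -
  let ?a = "real p * (real j + 1)" and ?c = "2 * real p * (real j + k) + 1"
  let ?t = "\<lambda>n. pochhammer ?a n / pochhammer ?c n * (v ^ n / fact n)"
  let ?K = "Gamma ?a / Gamma (2 * real p * (real j + k)) * v ^ (p * j)"
  have ac: "0 < ?a" "0 < ?c" "(1::real) \<le> 1" "?a \<le> 1 * ?c" "0 \<le> v"
    using assms real_of_nat_shifted_le[of p k j] by (auto simp: add_pos_pos)
  have K: "0 \<le> ?K"
    using assms ac by (intro mult_nonneg_nonneg divide_nonneg_nonneg less_imp_le[OF Gamma_real_pos]) auto
  have t: "(?t has_sum hyp1F1 ?a ?c v) UNIV"
    using hyp1F1_sums[OF ac] hyp1F1_term_bounds(1)[OF ac] by (intro sums_nonneg_imp_has_sum)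
  have t_eq: "dihedral_term p k v x j n = ?K * gegenbauer j k x * ?t n" for n
    by (simp add: dihedral_term_def mult_ac)
  have norm_term: "norm (dihedral_term p k v x j n) = ?K * \<bar>gegenbauer j k x\<bar> * ?t n" for n
    unfolding t_eq real_norm_def abs_mult[of _ "?t n"] abs_of_nonneg[OF hyp1F1_term_bounds(1)[OF ac]]
    unfolding abs_mult[of _ "gegenbauer j k x"] abs_of_nonneg[OF K] ..
  show "(dihedral_term p k v x j has_sum ?L) UNIV"
    using has_sum_cmult_right[OF t, of "?K * gegenbauer j k x"] by (simp add: t_eq[abs_def] mult_ac)
  have abs: "((\<lambda>n. norm (dihedral_term p k v x j n)) has_sum ?K * \<bar>gegenbauer j k x\<bar> * hyp1F1 ?a ?c v) UNIV"
    unfolding norm_term by (rule has_sum_cmult_right[OF t])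
  then show "(\<lambda>n. norm (dihedral_term p k v x j n)) summable_on UNIV"
    by (rule has_sum_imp_summable)
  have "(\<Sum>\<^sub>\<infinity>n. norm (dihedral_term p k v x j n)) = ?K * \<bar>gegenbauer j k x\<bar> * hyp1F1 ?a ?c v"
    using abs by (rule infsumI)
  also have "\<dots> \<le> ?K * \<bar>gegenbauer j k x\<bar> * exp v"
    by (rule mult_left_mono[OF hyp1F1_le_exp[OF ac, unfolded mult_1] mult_nonneg_nonneg[OF K abs_ge_zero]])
  finally show "(\<Sum>\<^sub>\<infinity>n. norm (dihedral_term p k v x j n)) \<le> ?K * exp v * \<bar>gegenbauer j k x\<bar>"
    by (simp add: mult_ac)
qed

text \<open>The row sums are at most K (3 v^p)^j / j!, where exp v bounds the 1F1, 3^j bounds the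
  Gegenbauer value and (pj)! is weakened to j!. An exponential series therefore dominates
  them.\<close>

lemma dihedral_term_abs_summable:
  assumes p: "2 \<le> p" and k: "1 / 2 < k" "k \<le> 1" and v: "0 < v" and x: "\<bar>x\<bar> \<le> 1"
  shows "(\<lambda>jn. norm ((\<lambda>(j, n). dihedral_term p k v x j n) jn)) summable_on UNIV"
proof -
  let ?N = "\<lambda>j. \<Sum>\<^sub>\<infinity>n. norm (dihedral_term p k v x j n)"
  define K where "K = Gamma (real p) / Gamma (2 * real p * k) * exp v"
  have K: "0 \<le> K"
    unfolding K_def using p k by (intro mult_nonneg_nonneg divide_nonneg_nonneg less_imp_le[OF Gamma_real_pos]) auto
  have bound: "norm (?N j) \<le> K * ((3 * v ^ p) ^ j / fact j)" for j
  proof -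
    have "0 \<le> ?N j" by (intro infsum_nonneg) auto
    moreover have "?N j \<le> Gamma (real p * (real j + 1)) / Gamma (2 * real p * (real j + k)) * v ^ (p * j) * exp v * \<bar>gegenbauer j k x\<bar>"
      using p k v by (intro dihedral_term_sums)
    moreover have "\<dots> \<le> Gamma (real p) / Gamma (2 * real p * k) / fact (p * j) * v ^ (p * j) * exp v * 3 ^ j"
      using p k v x Gamma_ratio_le[of p k j] abs_gegenbauer_le[of k x j]
      by (intro mult_mono mult_nonneg_nonneg divide_nonneg_nonneg less_imp_le[OF Gamma_real_pos] add_pos_pos) auto
    moreover have "\<dots> = K * ((3 * v ^ p) ^ j) * (1 / fact (p * j))"
      unfolding K_def power_mult_distrib power_mult[of v p j] by simp
    moreover have "K * ((3 * v ^ p) ^ j) * (1 / fact (p * j)) \<le> K * ((3 * v ^ p) ^ j) * (1 / fact j)"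
      using K v p by (intro mult_left_mono divide_left_mono fact_mono) auto
    ultimately show ?thesis by simp
  qed
  have "summable (\<lambda>j. norm (?N j))"
    using bound by (intro summable_comparison_test'[OF summable_mult[OF summable_exp_real[of "3 * v ^ p"], of K]]) simp
  then have "(\<lambda>j. norm (?N j)) summable_on UNIV"
    by (intro norm_summable_imp_summable_on) simp
  then have "(\<lambda>jn. norm ((\<lambda>(j, n). dihedral_term p k v x j n) jn)) summable_on (SIGMA j:UNIV. UNIV)"
    unfolding Infinite_Sum.abs_summable_on_Sigma_iff using dihedral_term_sums(3)[OF p k(1) v] by simp
  then show ?thesis by simp
qed

theorem proposition1:
  fixes p :: nat and k \<phi> v :: real
  assumes "2 \<le> p"
    and "1 / 2 < k" and "k \<le> 1"
    and "0 < \<phi>" and "\<phi> < pi / (2 * real p)"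
    and "0 < v"
  shows "(\<lambda>j::nat.
            Gamma (real p * (real j + 1)) / Gamma (2 * real p * (real j + k)) * v ^ (p * j)
            * hyp1F1 (real p * (real j + 1)) (2 * real p * (real j + k) + 1) v
            * gegenbauer j k (cos (2 * real p * \<phi>)))
         sums
         (Gamma (real p) * Gamma (real p * k) / (Gamma k ^ p * Gamma (2 * real p * k))
          * simplex_integral p (\<lambda>u.
              (\<Prod>s = 1..p. u s powr (k - 1))
              * hyp1F1 (real p) (real p * k + 1 / 2)
                  (v * (\<Sum>s = 1..p. u s * (cos (\<phi> + real s * pi / real p))\<^sup>2))))"
proof -
  let ?x = "cos (2 * real p * \<phi>)" and ?z = "\<lambda>s. (cos (\<phi> + real s * pi / real p))\<^sup>2"
  let ?t = "\<lambda>j n. dihedral_term p k v ?x j n"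
  let ?L = "\<lambda>j. Gamma (real p * (real j + 1)) / Gamma (2 * real p * (real j + k)) * v ^ (p * j)
            * hyp1F1 (real p * (real j + 1)) (2 * real p * (real j + k) + 1) v * gegenbauer j k ?x"
  define R where "R = Gamma (real p) * Gamma (real p * k) / (Gamma k ^ p * Gamma (2 * real p * k))"
  define c where "c m = pochhammer (real p) m / pochhammer (real p * k + 1 / 2) m * (v ^ m / fact m)" for m
  define d where "d m = fact m * Gamma k ^ p / Gamma (real p * k + real m) *
      fps_rpow (\<Prod>s = 1..p. 1 - fps_const (?z s) * fps_X) (- k) $ m" for m
  have p: "0 < p" and k: "0 < k" using assms by auto
  have R: "R \<noteq> 0"
  proof -
    have "Gamma a \<noteq> 0" if "0 < a" for a :: real
      using Gamma_real_pos[OF that] by simp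
    then show ?thesis using p k by (simp add: R_def)
  qed
  \<comment> \<open>\<open>S\<close> is the value of the double sum. Summing over \<open>n\<close>
    inside turns it into the left-hand side.\<close>
  obtain S where S: "((\<lambda>(j, n). ?t j n) has_sum S) UNIV"
    using abs_summable_summable[OF dihedral_term_abs_summable[of p k v ?x]] assms
    by (auto simp: summable_on_def)
  then have "((\<lambda>(j, n). ?t j n) has_sum S) (SIGMA j:UNIV. UNIV)"
    by simp
  then have "(?L has_sum S) UNIV"
    by (rule has_sum_SigmaD) (use dihedral_term_sums(1)[of p k v ?x] assms in simp)
  then have L: "?L sums S"
    by (rule has_sum_imp_sums)

  \<comment> \<open>The same family is regrouped by the exponent m = pj + n of \<open>v\<close>. The
    truncated subtraction \<open>m - p * j\<close> recovers n exactly, because p j \<le> m on the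
    index set, and each fibre is finite.\<close>
  have "bij_betw (\<lambda>(m, j). (j, m - p * j)) (SIGMA m:UNIV. {j. p * j \<le> m}) UNIV"
    by (intro bij_betwI[where g = "\<lambda>(j, n). (p * j + n, j)"]) auto
  then have "((\<lambda>y. (\<lambda>(j, n). ?t j n) ((\<lambda>(m, j). (j, m - p * j)) y)) has_sum S) (SIGMA m:UNIV. {j. p * j \<le> m})"
    using S by (subst has_sum_reindex_bij_betw) auto
  then have "((\<lambda>m. \<Sum>j | p * j \<le> m. ?t j (m - p * j)) has_sum S) UNIV"
  proof (rule has_sum_SigmaD)
    fix m
    have "{j. p * j \<le> m} \<subseteq> {..m}"
      using le_of_pos_mult_le[OF p] by blast
    then have "finite {j. p * j \<le> m}"
      by (rule finite_subset) simp
    then show "((\<lambda>j. (\<lambda>(j, n). ?t j n) ((\<lambda>(m, j). (j, m - p * j)) (m, j))) has_sum (\<Sum>j | p * j \<le> m. ?t j (m - p * j))) {j. p * j \<le> m}"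
      by (auto intro: has_sum_finiteI)
  qed
  moreover have "(\<Sum>j | p * j \<le> m. ?t j (m - p * j)) = R * (c m * d m)" for m
  proof -
    have "(\<Sum>j | p * j \<le> m. ?t j (m - p * j)) = (\<Sum>j | p * j \<le> m. R * (c m * (fact m * Gamma k ^ p / Gamma (real p * k + real m) *
      (gegenbauer j k ?x / 4 ^ (p * j) * quad_hypergeo (real p * (real j + k)) $ (m - p * j)))))"
      unfolding R_def c_def using assms(1) k by (intro sum.cong refl dihedral_term_eq) auto
    then show ?thesis
      by (simp only: d_def dihedral_coeff[OF p k] sum_distrib_left[symmetric])
  qed
  ultimately have "(\<lambda>m. R * (c m * d m)) sums S"
    by (simp add: has_sum_imp_sums)
  then have cd: "(\<lambda>m. c m * d m) sums (S / R)"
    using sums_mult[of "\<lambda>m. R * (c m * d m)" S "1 / R"] R by simp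

  have ac: "0 < real p" "0 < real p * k + 1 / 2" "(1 :: real) \<le> 2" "real p \<le> 2 * (real p * k + 1 / 2)"
  proof -
    have "real p * 1 \<le> real p * (2 * k)" using assms by (intro mult_left_mono) auto
    then show "real p \<le> 2 * (real p * k + 1 / 2)" by simp
  qed (use p k in \<open>auto intro: add_nonneg_pos\<close>)
  have hyp: "(\<lambda>m. c m * y ^ m) sums hyp1F1 (real p) (real p * k + 1 / 2) (v * y)" if "0 \<le> y" for y
    using hyp1F1_sums[OF ac, of "v * y"] that assms by (simp add: c_def power_mult_distrib mult_ac)
  have hyp': "hyp1F1 (real p) (real p * k + 1 / 2) (v * y) = (\<Sum>m. c m * y ^ m)" for y
    by (simp add: hyp1F1_def c_def power_mult_distrib mult_ac)
  have "simplex_integral p (\<lambda>u. (\<Prod>s = 1..p. u s powr (k - 1)) * (\<Sum>m. c m * (\<Sum>s = 1..p. u s * ?z s) ^ m)) = S / R"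
  proof (rule simplex_integral_power_series)
    show "0 \<le> c m" for m
      unfolding c_def by (rule hyp1F1_term_bounds(1)[OF ac less_imp_le[OF assms(6)]])
    show "summable (\<lambda>m. c m * y ^ m)" if "0 \<le> y" for y
      using hyp[OF that] by (rule sums_summable)
    show "(\<lambda>m. c m * (fact m * Gamma k ^ p / Gamma (real p * k + real m) *
      fps_rpow (\<Prod>s = 1..p. 1 - fps_const (?z s) * fps_X) (- k) $ m)) sums (S / R)"
      using cd by (simp only: d_def)
  qed (use p k in auto)
  then have "S = R * simplex_integral p (\<lambda>u. (\<Prod>s = 1..p. u s powr (k - 1)) *
      hyp1F1 (real p) (real p * k + 1 / 2) (v * (\<Sum>s = 1..p. u s * ?z s)))"
    using R by (simp add: hyp')
  then show ?thesis
    using L unfolding R_def by (simp only:)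
qed

end
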